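(* Let $N\in\mathbb N$ and $w\in\mathbb N$. The $K_N$-vector space $\mathcal{CZ}_{N,w}\subset K_{N,\infty}$ spanned by the $N$th cyclotomic multiple zeta values of weight $w$ and the $K_N$-vector space $\mathcal{CL}_{N,w}\subset K_{N,\infty}$ spanned by the Carlitz multiple polylogarithms at $N$th roots of unity of weight $w$ are the same.
   Context: $\mathbb N=\{1,2,\dots\}$. Let $q$ be a power of a prime $p$, $k=\mathbb F_q$, $A=\mathbb F_q[\theta]$ the polynomial ring in $\theta$, and $A_+$ the set of monic polynomials in $A$. Let $\bar k$ be an algebraic closure of $k$. For $N\in\mathbb N$, $\Gamma_N\subset\bar k^\times$ is the group of $N$th roots of unity, $k_N=k(\Gamma_N)\subset\bar k$, $K_N=k_N(\theta)$, and $K_{N,\infty}=k_N((1/\theta))$. For $n\ge 1$, $s_1,\dots,s_n\in\mathbb N$ and $\epsilon_1,\dots,\epsilon_n\in\Gamma_N$, the $N$th cyclotomic multiple zeta value is $$\zeta_A\begin{pmatrix}\epsilon_1&\dots&\epsilon_n\\ s_1&\dots&s_n\end{pmatrix}=\sum_{\substack{a_1,\dots,a_n\in A_+\\ \deg a_1>\dots>\deg a_n\ge 0}}\frac{\epsilon_1^{\deg a_1}\cdots\epsilon_n^{\deg a_n}}{a_1^{s_1}\cdots a_n^{s_n}}\in K_{N,\infty}.$$ Put $\ell_0=1$ and $\ell_d=\prod_{i=1}^d(\theta-\theta^{q^i})$ for $d\in\mathbb N$. The Carlitz multiple polylogarithm at $N$th roots of unity is $$\operatorname{Li}\begin{pmatrix}\epsilon_1&\dots&\epsilon_n\\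 s_1&\dots&s_n\end{pmatrix}=\sum_{d_1>\dots>d_n\ge 0}\frac{\epsilon_1^{d_1}\cdots\epsilon_n^{d_n}}{\ell_{d_1}^{s_1}\cdots\ell_{d_n}^{s_n}}\in K_{N,\infty}.$$ In both cases the weight is $s_1+\dots+s_n$. *)

theory Defs
  imports
    "HOL-Library.Cardinality"
    "HOL-Analysis.Infinite_Sum"
    "HOL-Computational_Algebra.Formal_Laurent_Series"
    "HOL-Algebra.Algebraic_Closure_Type"
    "HOL-Algebra.Generated_Fields"
begin

unbundle Formal_Laurent_Series.fps_syntax

text \<open>
  The base field \<open>k = \<F>\<^sub>q\<close> is an arbitrary type \<open>'k\<close> of sort \<open>{finite, field}\<close>, so that \<open>q = CARD('k)\<close>
  (automatically a prime power), and \<open>A = \<F>\<^sub>q[\<theta>]\<close> is \<open>'k poly\<close>. All values live in the field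
  \<open>'k alg_closure fls\<close> of Laurent series over the algebraic closure of \<open>k\<close> whose formal variable
  \<open>fls_X\<close> is \<open>1/\<theta>\<close>. For a fixed \<open>N\<close>, the fields \<open>k\<^sub>N\<close>, \<open>K\<^sub>N\<close> and \<open>K\<^bsub>N,\<infinity>\<^esub>\<close> are subsets of
  \<open>'k alg_closure\<close> and of \<open>'k alg_closure fls\<close>; lemmas \<open>CZ_subset_laurent\<close> and
  \<open>CL_subset_laurent\<close> below show that both spaces lie in \<open>K\<^bsub>N,\<infinity>\<^esub>\<close>.
\<close>

definition theta :: "'k::field alg_closure fls"
  where "theta = fls_X_inv"

definition emb :: "'k::field poly \<Rightarrow> 'k alg_closure fls"
  where "emb a = poly (map_poly (\<lambda>c. fls_const (to_ac c)) a) theta"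

definition roots_unity :: "nat \<Rightarrow> 'k::field alg_closure set"
  where "roots_unity N = {x. x ^ N = 1}"

text \<open>\<open>k\<^sub>N = k(\<Gamma>\<^sub>N)\<close>, \<open>K\<^sub>N = k\<^sub>N(\<theta>)\<close> and \<open>K\<^bsub>N,\<infinity>\<^esub> = k\<^sub>N((1/\<theta>))\<close>.\<close>

definition cyc_const_field :: "nat \<Rightarrow> 'k::field alg_closure set"
  where "cyc_const_field N = generate_field ring_of_type_algebra (range to_ac \<union> roots_unity N)"

definition cyc_rat_field :: "nat \<Rightarrow> 'k::field alg_closure fls set"
  where "cyc_rat_field N =
    generate_field ring_of_type_algebra (insert theta (fls_const ` cyc_const_field N))"

definition cyc_laurent_field :: "nat \<Rightarrow> 'k::field alg_closure fls set"
  where "cyc_laurent_field N = {f. \<forall>n. f $$ n \<in> cyc_const_field N}"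

text \<open>
  The infinite sums below are unconditional sums in the \<open>1/\<theta>\<close>-adic metric of Laurent series;
  \<open>infsum\<close> would be \<open>0\<close> for a divergent family, but lemmas \<open>cyc_mzv_summable\<close> and
  \<open>cmpl_summable\<close> show that this never happens for exponents \<open>s\<^sub>i \<ge> 1\<close>. Tuples are lists: \<open>eps = [\<epsilon>\<^sub>1, \<dots>, \<epsilon>\<^sub>n]\<close>
  and \<open>s = [s\<^sub>1, \<dots>, s\<^sub>n]\<close>.
\<close>

definition decreasing_monics :: "nat \<Rightarrow> 'k::field poly list set"
  where "decreasing_monics n =
    {as. length as = n \<and> (\<forall>a\<in>set as. lead_coeff a = 1) \<and>
         sorted_wrt (\<lambda>a b. degree a > degree b) as}"

definition cyc_mzv :: "'k::field alg_closure list \<Rightarrow> nat list \<Rightarrow> 'k alg_closure fls"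
  where "cyc_mzv eps s =
    (\<Sum>\<^sub>\<infinity>as\<in>decreasing_monics (length s).
      \<Prod>i<length s. fls_const ((eps ! i) ^ degree (as ! i)) / emb (as ! i) ^ (s ! i))"

definition ell :: "nat \<Rightarrow> 'k::{finite,field} poly"
  where "ell d = (\<Prod>i=1..d. monom 1 1 - monom 1 (CARD('k) ^ i))"

definition decreasing_nats :: "nat \<Rightarrow> nat list set"
  where "decreasing_nats n = {ds. length ds = n \<and> sorted_wrt (>) ds}"

definition cmpl :: "'k::{finite,field} alg_closure list \<Rightarrow> nat list \<Rightarrow> 'k alg_closure fls"
  where "cmpl eps s =
    (\<Sum>\<^sub>\<infinity>ds\<in>decreasing_nats (length s).
      \<Prod>i<length s. fls_const ((eps ! i) ^ (ds ! i)) / emb (ell (ds ! i)) ^ (s ! i))"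

definition cyc_indices :: "nat \<Rightarrow> nat \<Rightarrow> ('k::field alg_closure list \<times> nat list) set"
  where "cyc_indices N w =
    {(eps, s). s \<noteq> [] \<and> length eps = length s \<and> set eps \<subseteq> roots_unity N \<and>
               (\<forall>x\<in>set s. x \<ge> 1) \<and> sum_list s = w}"

definition span_over :: "'a::field set \<Rightarrow> 'a set \<Rightarrow> 'a set"
  where "span_over K S = {\<Sum>v\<in>T. c v * v |T c. finite T \<and> T \<subseteq> S \<and> (\<forall>v\<in>T. c v \<in> K)}"

definition CZ :: "nat \<Rightarrow> nat \<Rightarrow> 'k::{finite,field} alg_closure fls set"
  where "CZ N w = span_over (cyc_rat_field N) {cyc_mzv eps s |eps s. (eps, s) \<in> cyc_indices N w}"

definition CL :: "nat \<Rightarrow> nat \<Rightarrow> 'k::{finite,field} alg_closure fls set"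
  where "CL N w = span_over (cyc_rat_field N) {cmpl eps s |eps s. (eps, s) \<in> cyc_indices N w}"


subsection \<open>Convergence\<close>

lemma fls_summable:
  fixes f :: "'i \<Rightarrow> 'a::field fls"
  assumes fin: "\<And>m. finite {i\<in>A. f i \<noteq> 0 \<and> fls_subdegree (f i) < m}"
  shows "f summable_on A"
    and "infsum f A $$ n = (\<Sum>i | i \<in> A \<and> f i $$ n \<noteq> 0. f i $$ n)"
proof -
  define S where "S n = {i\<in>A. f i $$ n \<noteq> 0}" for n
  define g where "g n = (\<Sum>i\<in>S n. f i $$ n)" for n
  have S_sub: "S n \<subseteq> {i\<in>A. f i \<noteq> 0 \<and> fls_subdegree (f i) < n + 1}" for n
    by (auto simp: S_def dest: fls_subdegree_leI)
  have finS: "finite (S n)" for n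
    using finite_subset[OF S_sub fin] .
  define F0 where "F0 = {i\<in>A. f i \<noteq> 0 \<and> fls_subdegree (f i) < 0}"
  define M where "M = Min (insert 0 ((\<lambda>i. fls_subdegree (f i)) ` F0))"
  have finF0: "finite F0" unfolding F0_def by (rule fin)
  have g0: "g n = 0" if "n < M" for n
  proof -
    have "S n = {}"
    proof (rule ccontr)
      assume "S n \<noteq> {}"
      then obtain i where i: "i \<in> A" "f i $$ n \<noteq> 0" by (auto simp: S_def)
      have "M \<le> 0" unfolding M_def using finF0 by simp
      with that have "n < 0" by simp
      moreover have le: "fls_subdegree (f i) \<le> n" using i fls_subdegree_leI by blast
      ultimately have "i \<in> F0" using i by (auto simp: F0_def)
      hence "M \<le> fls_subdegree (f i)" unfolding M_def using finF0 by (intro Min_le) auto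
      with le that show False by simp
    qed
    thus ?thesis by (simp add: g_def)
  qed
  define G where "G = Abs_fls g"
  have G: "G $$ n = g n" for n
    unfolding G_def by (rule nth_Abs_fls_lower_bound[of M]) (use g0 in auto)
  have "(f has_sum G) A"
    unfolding has_sum_def tendsto_iff
  proof (intro allI impI)
    fix e :: real assume "e > 0"
    then obtain m :: nat where m: "inverse (2 ^ m) < e"
      using real_arch_pow_inv[of e "1 / 2"] by (auto simp: power_one_over inverse_eq_divide)
    define F where "F = {i\<in>A. f i \<noteq> 0 \<and> fls_subdegree (f i) < int m + 1}"
    have "dist (sum f Y) G < e" if Y: "finite Y" "F \<subseteq> Y" "Y \<subseteq> A" for Y
    proof -
      have co: "(sum f Y - G) $$ n = 0" if "n \<le> int m" for n
      proof -
        have "S n \<subseteq> Y" using S_sub[of n] that Y by (force simp: F_def)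
        hence "(\<Sum>i\<in>Y. f i $$ n) = g n"
          unfolding g_def using Y by (intro sum.mono_neutral_right) (auto simp: S_def)
        thus ?thesis by (simp add: G fls_nth_sum)
      qed
      show ?thesis
      proof (cases "sum f Y = G")
        case True
        thus ?thesis using \<open>e > 0\<close> by simp
      next
        case False
        hence sd: "int m < fls_subdegree (sum f Y - G)"
          using co by (intro fls_subdegree_greaterI) auto
        have "dist (sum f Y) G = inverse (2 ^ nat (fls_subdegree (sum f Y - G)))"
          using sd False by (simp add: dist_fls_def)
        also have "\<dots> \<le> inverse (2 ^ m)"
          using sd by (intro le_imp_inverse_le power_increasing) auto
        finally show ?thesis using m by simp
      qed
    qed
    moreover have "finite F" "F \<subseteq> A" using fin[of "int m + 1"] by (auto simp: F_def)
    ultimately show "\<forall>\<^sub>F Y in finite_subsets_at_top A. dist (sum f Y) G < e"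
      by (auto simp: eventually_finite_subsets_at_top intro!: exI[of _ F])
  qed
  from this show "f summable_on A" unfolding summable_on_def ..
  from \<open>(f has_sum G) A\<close> have "infsum f A = G" by (rule infsumI)
  thus "infsum f A $$ n = (\<Sum>i | i \<in> A \<and> f i $$ n \<noteq> 0. f i $$ n)"
    by (simp only: G g_def S_def)
qed

lemma emb_nth: "emb a $$ n = (if n \<le> 0 then to_ac (coeff a (nat (- n))) else 0)"
proof -
  have "degree (map_poly (\<lambda>c. fls_const (to_ac c)) a) = degree a"
    by (rule degree_map_poly) auto
  hence "emb a $$ n = (\<Sum>i\<le>degree a. if n = - int i then to_ac (coeff a i) else 0)"
    by (simp add: emb_def theta_def poly_altdef fls_nth_sum coeff_map_poly if_distrib cong: if_cong)
  also have "\<dots> = (\<Sum>i\<in>{i. i \<le> degree a \<and> n = - int i}. to_ac (coeff a i))"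
    by (subst sum.inter_filter[symmetric]) (auto simp: atMost_def)
  also have "{i. i \<le> degree a \<and> n = - int i} =
      (if n \<le> 0 \<and> nat (- n) \<le> degree a then {nat (- n)} else {})"
    by auto
  also have "(\<Sum>i\<in>\<dots>. to_ac (coeff a i)) = (if n \<le> 0 then to_ac (coeff a (nat (- n))) else 0)"
    by (auto simp: coeff_eq_0)
  finally show ?thesis .
qed

lemma emb_eq_0_iff [simp]: "emb a = 0 \<longleftrightarrow> a = 0"
proof
  assume "emb a = 0"
  hence "emb a $$ (- int (degree a)) = 0" by simp
  thus "a = 0" by (simp add: emb_nth)
qed (simp add: emb_def)

lemma emb_subdegree [simp]: "fls_subdegree (emb a) = - int (degree a)"
proof (cases "a = 0")
  case False
  thus ?thesis
    by (intro fls_subdegree_eqI) (auto simp: emb_nth coeff_eq_0)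
qed (simp add: emb_def)

lemma fls_subdegree_prod_field:
  fixes F :: "'i \<Rightarrow> 'a::field fls"
  assumes "\<And>i. i \<in> I \<Longrightarrow> F i \<noteq> 0"
  shows "fls_subdegree (\<Prod>i\<in>I. F i) = (\<Sum>i\<in>I. fls_subdegree (F i))"
  using assms by (induction I rule: infinite_finite_induct) auto

lemma term_subdegree:
  fixes b :: "nat \<Rightarrow> 'k::field poly" and c :: "nat \<Rightarrow> 'k alg_closure"
  assumes nz: "(\<Prod>i<n. fls_const (c i) / emb (b i) ^ (e i)) \<noteq> 0"
  shows "fls_subdegree (\<Prod>i<n. fls_const (c i) / emb (b i) ^ (e i)) = (\<Sum>i<n. int (e i * degree (b i)))"
proof -
  have fac: "fls_const (c i) / emb (b i) ^ (e i) \<noteq> 0" if "i < n" for i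
  proof
    assume "fls_const (c i) / emb (b i) ^ (e i) = 0"
    with that have "\<exists>i\<in>{..<n}. fls_const (c i) / emb (b i) ^ (e i) = 0" by blast
    from prod_zero[OF finite_lessThan this] nz show False by contradiction
  qed
  have "fls_subdegree (\<Prod>i<n. fls_const (c i) / emb (b i) ^ (e i)) =
      (\<Sum>i<n. fls_subdegree (fls_const (c i) / emb (b i) ^ (e i)))"
    using fac by (intro fls_subdegree_prod_field) auto
  also have "\<dots> = (\<Sum>i<n. int (e i * degree (b i)))"
  proof (rule sum.cong[OF refl])
    fix i assume "i \<in> {..<n}"
    hence nz': "fls_const (c i) / emb (b i) ^ (e i) \<noteq> 0" using fac by simp
    have "fls_const (c i) \<noteq> 0" "emb (b i) ^ (e i) \<noteq> 0"
      using nz' by (auto simp del: power_eq_0_iff)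
    thus "fls_subdegree (fls_const (c i) / emb (b i) ^ (e i)) = int (e i * degree (b i))"
      by (subst fls_divide_subdegree) (simp_all add: fls_subdegree_pow)
  qed
  finally show ?thesis .
qed

lemma finite_polys_degree_less: "finite {a :: 'k::{finite,field} poly. degree a < m}"
proof -
  have "{a :: 'k poly. degree a < m} \<subseteq> Poly ` {xs. set xs \<subseteq> UNIV \<and> length xs \<le> m}"
  proof
    fix a :: "'k poly" assume "a \<in> {a. degree a < m}"
    hence "length (coeffs a) \<le> m" by (cases "a = 0") (auto simp: length_coeffs_degree)
    thus "a \<in> Poly ` {xs. set xs \<subseteq> UNIV \<and> length xs \<le> m}"
      by (intro image_eqI[of _ _ "coeffs a"]) auto
  qed
  thus ?thesis by (rule finite_subset) (intro finite_imageI finite_lists_length_le, simp)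
qed

lemma degree_ell: "degree (ell d :: 'k::{finite,field} poly) = (\<Sum>i=1..d. CARD('k) ^ i)"
  and ell_nonzero: "(ell d :: 'k::{finite,field} poly) \<noteq> 0"
proof -
  have card: "CARD('k) > 1"
  proof -
    have "card {0, 1 :: 'k} \<le> CARD('k)" by (intro card_mono) auto
    thus ?thesis by simp
  qed
  have deg: "degree (monom 1 1 - monom (1::'k) (CARD('k) ^ i)) = CARD('k) ^ i" if "i \<ge> 1" for i
  proof -
    have "CARD('k) ^ i > 1" using card that by (intro one_less_power) auto
    hence "degree (monom 1 1 + - monom (1::'k) (CARD('k) ^ i)) = degree (- monom (1::'k) (CARD('k) ^ i))"
      by (intro degree_add_eq_right) (simp add: degree_monom_eq)
    thus ?thesis by (simp add: degree_monom_eq)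
  qed
  have nz: "monom 1 1 - monom (1::'k) (CARD('k) ^ i) \<noteq> 0" if "i \<in> {1..d}" for i
    using deg[of i] that by force
  show "degree (ell d :: 'k poly) = (\<Sum>i=1..d. CARD('k) ^ i)"
    unfolding ell_def by (subst degree_prod_eq_sum_degree) (use nz deg in auto)
  show "(ell d :: 'k poly) \<noteq> 0"
    unfolding ell_def using nz by auto
qed

lemma degree_ell_ge: "d \<le> degree (ell d :: 'k::{finite,field} poly)"
proof -
  have "(\<Sum>i=1..d. 1) \<le> (\<Sum>i=1..d. CARD('k) ^ i)" by (intro sum_mono) auto
  thus ?thesis by (simp add: degree_ell)
qed

lemma cyc_mzv_summable:
  fixes eps :: "'k::{finite,field} alg_closure list"
  assumes s: "\<forall>x\<in>set s. x \<ge> 1"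
  defines "f \<equiv> (\<lambda>as. \<Prod>i<length s. fls_const ((eps ! i) ^ degree (as ! i)) / emb (as ! i) ^ (s ! i))"
  shows "finite {as \<in> decreasing_monics (length s). f as \<noteq> 0 \<and> fls_subdegree (f as) < m}"
    and "f summable_on decreasing_monics (length s)"
proof -
  show fin: "finite {as \<in> decreasing_monics (length s). f as \<noteq> 0 \<and> fls_subdegree (f as) < m}" for m
  proof (rule finite_subset)
    show "{as \<in> decreasing_monics (length s). f as \<noteq> 0 \<and> fls_subdegree (f as) < m} \<subseteq>
      {as. set as \<subseteq> {a. degree a < nat m} \<and> length as = length s}"
    proof safe
      fix as a assume as: "as \<in> decreasing_monics (length s)" "f as \<noteq> 0" "fls_subdegree (f as) < m"
        and a: "a \<in> set as"
      have len: "length as = length s" using as by (simp add: decreasing_monics_def)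
      obtain j where j: "j < length s" "a = as ! j" using a len by (metis in_set_conv_nth)
      have sj: "1 \<le> s ! j" using s j by auto
      have "int (degree a) \<le> int (s ! j * degree (as ! j))"
        using j sj mult_right_mono[OF sj, of "degree (as ! j)"] by (simp del: of_nat_mult)
      also have "\<dots> \<le> (\<Sum>i<length s. int (s ! i * degree (as ! i)))"
        using j by (intro member_le_sum) auto
      also have "\<dots> = fls_subdegree (f as)"
        using as(2) unfolding f_def by (rule term_subdegree[symmetric])
      finally show "degree a < nat m" using as(3) by linarith
    next
      fix as assume "as \<in> decreasing_monics (length s)"
      thus "length as = length s" by (simp add: decreasing_monics_def)
    qed
    show "finite {as :: 'k poly list. set as \<subseteq> {a. degree a < nat m} \<and> length as = length s}"
      by (intro finite_lists_length_eq finite_polys_degree_less)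
  qed
  show "f summable_on decreasing_monics (length s)"
    using fin by (rule fls_summable)
qed

lemma cmpl_summable:
  fixes eps :: "'k::{finite,field} alg_closure list"
  assumes s: "\<forall>x\<in>set s. x \<ge> 1"
  defines "f \<equiv> (\<lambda>ds. \<Prod>i<length s. fls_const ((eps ! i) ^ (ds ! i)) / emb (ell (ds ! i)) ^ (s ! i))"
  shows "finite {ds \<in> decreasing_nats (length s). f ds \<noteq> 0 \<and> fls_subdegree (f ds) < m}"
    and "f summable_on decreasing_nats (length s)"
proof -
  show fin: "finite {ds \<in> decreasing_nats (length s). f ds \<noteq> 0 \<and> fls_subdegree (f ds) < m}" for m
  proof (rule finite_subset)
    show "{ds \<in> decreasing_nats (length s). f ds \<noteq> 0 \<and> fls_subdegree (f ds) < m} \<subseteq>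
      {ds. set ds \<subseteq> {..<nat m} \<and> length ds = length s}"
    proof safe
      fix ds d assume ds: "ds \<in> decreasing_nats (length s)" "f ds \<noteq> 0" "fls_subdegree (f ds) < m"
        and d: "d \<in> set ds"
      have len: "length ds = length s" using ds by (simp add: decreasing_nats_def)
      obtain j where j: "j < length s" "d = ds ! j" using d len by (metis in_set_conv_nth)
      have sj: "1 \<le> s ! j" using s j by auto
      have "int d \<le> int (degree (ell d :: 'k poly))" using degree_ell_ge[of d, where ?'k = 'k] by simp
      also have "\<dots> \<le> int (s ! j * degree (ell (ds ! j) :: 'k poly))"
        using j sj mult_right_mono[OF sj, of "degree (ell (ds ! j) :: 'k poly)"] by (simp del: of_nat_mult)
      also have "\<dots> \<le> (\<Sum>i<length s. int (s ! i * degree (ell (ds ! i) :: 'k poly)))"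
        using j by (intro member_le_sum) auto
      also have "\<dots> = fls_subdegree (f ds)"
        using ds(2) unfolding f_def by (rule term_subdegree[symmetric])
      finally show "d < nat m" using ds(3) by linarith
    next
      fix ds assume "ds \<in> decreasing_nats (length s)"
      thus "length ds = length s" by (simp add: decreasing_nats_def)
    qed
    show "finite {ds :: nat list. set ds \<subseteq> {..<nat m} \<and> length ds = length s}"
      by (intro finite_lists_length_eq) simp
  qed
  show "f summable_on decreasing_nats (length s)"
    using fin by (rule fls_summable)
qed

subsection \<open>The values lie in \<open>K\<^bsub>N,\<infinity>\<^esub>\<close>\<close>

lemma
  fixes H :: "'a::field set"
  shows generate_field_zero: "0 \<in> generate_field ring_of_type_algebra H"
    and generate_field_one: "1 \<in> generate_field ring_of_type_algebra H"
    and generate_field_add: "\<And>x y. x \<in> generate_field ring_of_type_algebra H \<Longrightarrow>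
      y \<in> generate_field ring_of_type_algebra H \<Longrightarrow> x + y \<in> generate_field ring_of_type_algebra H"
    and generate_field_mult: "\<And>x y. x \<in> generate_field ring_of_type_algebra H \<Longrightarrow>
      y \<in> generate_field ring_of_type_algebra H \<Longrightarrow> x * y \<in> generate_field ring_of_type_algebra H"
    and generate_field_uminus: "\<And>x. x \<in> generate_field ring_of_type_algebra H \<Longrightarrow>
      - x \<in> generate_field ring_of_type_algebra H"
    and generate_field_inverse: "\<And>x. x \<in> generate_field ring_of_type_algebra H \<Longrightarrow>
      inverse x \<in> generate_field ring_of_type_algebra H"
proof -
  define R where "R = (ring_of_type_algebra :: 'a ring)"
  interpret R: field R unfolding R_def by (rule field_from_type_algebra)
  have R_simps: "carrier R = UNIV" "mult R = (*)" "one R = 1" "zero R = 0" "add R = (+)"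
    by (simp_all add: R_def ring_of_type_algebra_def)
  have uminus: "\<ominus>\<^bsub>R\<^esub> x = - x" for x
    using R.minus_equality[of "- x" x] by (simp add: R_simps)
  have inv: "inv\<^bsub>R\<^esub> x = inverse x" if "x \<noteq> 0" for x
    using R.comm_inv_char[of x "inverse x"] that by (simp add: R_simps)
  let ?L = "generate_field ring_of_type_algebra H"
  show 0: "0 \<in> ?L"
    using R.zero_in_generate[of H] by (simp only: R_simps R_def[symmetric])
  show "1 \<in> ?L"
    using generate_field.one[of R H] by (simp only: R_simps R_def[symmetric])
  show "x + y \<in> ?L" if "x \<in> ?L" "y \<in> ?L" for x y
    using generate_field.eng_add[of x R H y] that by (simp only: R_simps R_def[symmetric])
  show "x * y \<in> ?L" if "x \<in> ?L" "y \<in> ?L" for x y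
    using generate_field.eng_mult[of x R H y] that by (simp only: R_simps R_def[symmetric])
  show "- x \<in> ?L" if "x \<in> ?L" for x
    using generate_field.a_inv[of x R H] that by (simp only: uminus R_def[symmetric])
  show "inverse x \<in> ?L" if "x \<in> ?L" for x
  proof (cases "x = 0")
    case False
    thus ?thesis
      using generate_field.m_inv[of x R H] that by (simp only: inv R_simps R_def[symmetric] not_False_eq_True)
  qed (simp add: 0)
qed

lemma generate_field_sum:
  assumes "\<And>i. i \<in> I \<Longrightarrow> f i \<in> generate_field ring_of_type_algebra H"
  shows "(\<Sum>i\<in>I. f i) \<in> generate_field ring_of_type_algebra (H :: 'a::field set)"
  using assms
  by (induction I rule: infinite_finite_induct) (auto intro: generate_field_zero generate_field_add)

lemma cyc_laurent_mult:
  assumes "f \<in> cyc_laurent_field N" "g \<in> cyc_laurent_field N"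
  shows "f * g \<in> cyc_laurent_field N"
  using assms unfolding cyc_laurent_field_def cyc_const_field_def
  by (auto simp: fls_times_nth(2) intro!: generate_field_sum generate_field_mult)

lemma cyc_laurent_const: "c \<in> cyc_const_field N \<Longrightarrow> fls_const c \<in> cyc_laurent_field N"
  by (auto simp: cyc_laurent_field_def cyc_const_field_def intro: generate_field_zero)

lemma cyc_laurent_one: "1 \<in> cyc_laurent_field N"
  using cyc_laurent_const[of 1 N] by (simp add: cyc_const_field_def generate_field_one)

lemma cyc_laurent_power: "f \<in> cyc_laurent_field N \<Longrightarrow> f ^ n \<in> cyc_laurent_field N"
  by (induction n) (auto intro: cyc_laurent_one cyc_laurent_mult)

lemma cyc_laurent_prod:
  "(\<And>i. i \<in> I \<Longrightarrow> f i \<in> cyc_laurent_field N) \<Longrightarrow> (\<Prod>i\<in>I. f i) \<in> cyc_laurent_field N"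
  by (induction I rule: infinite_finite_induct) (auto intro: cyc_laurent_one cyc_laurent_mult)

lemma cyc_laurent_inverse:
  assumes f: "f \<in> cyc_laurent_field N"
  shows "inverse f \<in> cyc_laurent_field N"
proof (cases "f = 0")
  case False
  define g where "g = inverse f"
  define d where "d = fls_subdegree f"
  let ?L = "cyc_const_field N"
  note closed = generate_field_zero generate_field_one generate_field_add generate_field_mult
    generate_field_uminus generate_field_inverse generate_field_sum
  have sg: "fls_subdegree g = - d" using False by (simp add: g_def d_def)
  have fg: "f * g = 1" using False by (simp add: g_def)
  have fL: "f $$ n \<in> ?L" for n using f by (simp add: cyc_laurent_field_def)
  have "g $$ n \<in> ?L" for n
  proof (induction "nat (n + d + 1)" arbitrary: n rule: less_induct)
    case less
    show ?case
    proof (cases "n < - d")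
      case True
      hence "g $$ n = 0" using sg by simp
      thus ?thesis by (simp add: cyc_const_field_def closed)
    next
      case False
      define r where "r = (\<Sum>i=d+1..n + 2 * d. f $$ i * g $$ (n + d - i))"
      have "(f * g) $$ (n + d) = (\<Sum>i=d..n + 2 * d. f $$ i * g $$ (n + d - i))"
        by (simp add: fls_times_nth(2) sg d_def algebra_simps)
      also have "{d..n + 2 * d} = insert d {d+1..n + 2 * d}" using False by auto
      also have "(\<Sum>i\<in>\<dots>. f $$ i * g $$ (n + d - i)) = f $$ d * g $$ n + r"
        unfolding r_def by (subst sum.insert) auto
      finally have eq: "f $$ d * g $$ n = (1 :: 'a alg_closure fls) $$ (n + d) + - r"
        by (simp add: fg)
      have fd: "f $$ d \<noteq> 0" using \<open>f \<noteq> 0\<close> by (simp add: d_def)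
      have gn: "g $$ n = inverse (f $$ d) * ((1 :: 'a alg_closure fls) $$ (n + d) + - r)"
        unfolding eq[symmetric] using fd by (simp add: mult.assoc[symmetric])
      have "g $$ (n + d - i) \<in> ?L" if "i \<in> {d+1..n + 2 * d}" for i
        using that by (intro less) auto
      hence "r \<in> ?L"
        unfolding r_def using fL by (auto simp: cyc_const_field_def intro!: closed)
      moreover have "(1 :: 'a alg_closure fls) $$ (n + d) \<in> ?L"
        by (simp add: cyc_const_field_def closed(1,2))
      ultimately show ?thesis
        unfolding gn using fL[of d] unfolding cyc_const_field_def by (intro closed)
    qed
  qed
  thus ?thesis by (simp add: cyc_laurent_field_def g_def)
next
  case True
  thus ?thesis
    by (simp add: cyc_laurent_field_def cyc_const_field_def generate_field_zero)
qed

lemma cyc_laurent_emb: "emb a \<in> cyc_laurent_field N"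
  by (auto simp: cyc_laurent_field_def cyc_const_field_def emb_nth
      intro: generate_field_zero generate_field.incl)

lemma cyc_laurent_theta: "theta \<in> cyc_laurent_field N"
  by (auto simp: cyc_laurent_field_def cyc_const_field_def theta_def
      intro: generate_field_zero generate_field_one)

lemma cyc_rat_subset_laurent: "cyc_rat_field N \<subseteq> cyc_laurent_field N"
proof
  define R where "R = (ring_of_type_algebra :: 'a alg_closure fls ring)"
  interpret R: field R unfolding R_def by (rule field_from_type_algebra)
  have R_simps: "carrier R = UNIV" "mult R = (*)" "one R = 1" "zero R = 0" "add R = (+)"
    by (simp_all add: R_def ring_of_type_algebra_def)
  have uminus: "\<ominus>\<^bsub>R\<^esub> x = - x" for x
    using R.minus_equality[of "- x" x] by (simp add: R_simps)
  have inv: "inv\<^bsub>R\<^esub> x = inverse x" if "x \<noteq> 0" for x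
    using R.comm_inv_char[of x "inverse x"] that by (simp add: R_simps)
  fix x :: "'a alg_closure fls" assume "x \<in> cyc_rat_field N"
  hence "x \<in> generate_field R (insert theta (fls_const ` cyc_const_field N))"
    by (simp only: cyc_rat_field_def R_def)
  thus "x \<in> cyc_laurent_field N"
  proof induction
    case one
    show ?case using cyc_laurent_one by (simp add: R_simps)
  next
    case (incl h)
    thus ?case using cyc_laurent_theta cyc_laurent_const by auto
  next
    case (a_inv h)
    thus ?case by (auto simp: uminus cyc_laurent_field_def cyc_const_field_def
          intro: generate_field_uminus)
  next
    case (m_inv h)
    thus ?case by (simp add: R_simps inv cyc_laurent_inverse)
  next
    case (eng_add h1 h2)
    thus ?case by (auto simp: R_simps cyc_laurent_field_def cyc_const_field_def
          intro: generate_field_add)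
  next
    case (eng_mult h1 h2)
    thus ?case by (simp add: R_simps cyc_laurent_mult)
  qed
qed

lemma cyc_laurent_infsum:
  fixes f :: "'i \<Rightarrow> 'k::field alg_closure fls"
  assumes "\<And>m. finite {i\<in>A. f i \<noteq> 0 \<and> fls_subdegree (f i) < m}"
    and "\<And>i. i \<in> A \<Longrightarrow> f i \<in> cyc_laurent_field N"
  shows "infsum f A \<in> cyc_laurent_field N"
proof -
  have "infsum f A $$ n \<in> cyc_const_field N" for n
    unfolding fls_summable(2)[OF assms(1)] cyc_const_field_def
    by (intro generate_field_sum)
      (use assms(2) in \<open>auto simp: cyc_laurent_field_def cyc_const_field_def\<close>)
  thus ?thesis by (simp add: cyc_laurent_field_def)
qed

lemma root_in_cyc_laurent:
  "x \<in> roots_unity N \<Longrightarrow> fls_const (x ^ n) \<in> cyc_laurent_field N"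
  using cyc_laurent_power[OF cyc_laurent_const[of x N], of n]
  by (simp add: cyc_const_field_def generate_field.incl flip: fls_const_power)

lemma cyc_mzv_in_laurent:
  fixes eps :: "'k::{finite,field} alg_closure list"
  assumes "(eps, s) \<in> cyc_indices N w"
  shows "cyc_mzv eps s \<in> cyc_laurent_field N"
proof -
  have s: "\<forall>x\<in>set s. x \<ge> 1" and eps: "eps ! i \<in> roots_unity N" if "i < length s" for i
    using assms that by (auto simp: cyc_indices_def)
  show ?thesis
    unfolding cyc_mzv_def
    by (intro cyc_laurent_infsum cyc_mzv_summable(1) cyc_laurent_prod)
      (use assms eps in \<open>auto simp: cyc_indices_def field_class.field_divide_inverse
        intro!: cyc_laurent_mult cyc_laurent_inverse cyc_laurent_power root_in_cyc_laurent
          cyc_laurent_emb\<close>)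
qed

lemma cmpl_in_laurent:
  fixes eps :: "'k::{finite,field} alg_closure list"
  assumes "(eps, s) \<in> cyc_indices N w"
  shows "cmpl eps s \<in> cyc_laurent_field N"
proof -
  have eps: "eps ! i \<in> roots_unity N" if "i < length s" for i
    using assms that by (auto simp: cyc_indices_def)
  show ?thesis
    unfolding cmpl_def
    by (intro cyc_laurent_infsum cmpl_summable(1) cyc_laurent_prod)
      (use assms eps in \<open>auto simp: cyc_indices_def field_class.field_divide_inverse
        intro!: cyc_laurent_mult cyc_laurent_inverse cyc_laurent_power root_in_cyc_laurent
          cyc_laurent_emb\<close>)
qed

lemma span_over_laurent:
  assumes "S \<subseteq> cyc_laurent_field N"
  shows "span_over (cyc_rat_field N) S \<subseteq> cyc_laurent_field N"
proof
  fix x assume "x \<in> span_over (cyc_rat_field N) S"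
  then obtain T c where x: "x = (\<Sum>v\<in>T. c v * v)" "T \<subseteq> S" "\<forall>v\<in>T. c v \<in> cyc_rat_field N"
    unfolding span_over_def by blast
  have "c v * v \<in> cyc_laurent_field N" if "v \<in> T" for v
    using that x(2,3) assms cyc_rat_subset_laurent[of N] by (intro cyc_laurent_mult) blast+
  thus "x \<in> cyc_laurent_field N"
    unfolding x(1) by (auto simp: cyc_laurent_field_def cyc_const_field_def fls_nth_sum
        intro!: generate_field_sum)
qed

lemma CZ_subset_laurent: "CZ N w \<subseteq> cyc_laurent_field N"
  and CL_subset_laurent: "CL N w \<subseteq> cyc_laurent_field N"
  unfolding CZ_def CL_def
  by (rule span_over_laurent; use cyc_mzv_in_laurent cmpl_in_laurent in blast)+

end

theory Submission
  imports Defs "HOL-Library.Function_Algebras"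
begin

text \<open>
  Put \<open>Si\<^sub>d(s) = 1 / \<ell>\<^sub>d\<^sup>s\<close> and let \<open>S\<^sub>d(s)\<close> be the sum of \<open>1 / a\<^sup>s\<close> over the monic polynomials \<open>a\<close> of degree
  \<open>d\<close>. The values of both kinds are limits of nested sums over \<open>d\<^sub>1 > \<dots> > d\<^sub>n \<ge> 0\<close>, with the summands
  \<open>\<epsilon>\<^sub>i\<^sup>d Si\<^sub>d(s\<^sub>i)\<close> for the polylogarithms and \<open>\<epsilon>\<^sub>i\<^sup>d S\<^sub>d(s\<^sub>i)\<close> for the zeta values, where \<open>d = d\<^sub>i\<close>. In each
  weight the two families of nested sums, as functions of the truncation, generate the same additive
  group (\<open>nested_span_power_sum\<close>). The values then generate the same additive group as well, and
  therefore the same vector space over \<open>K\<^sub>N\<close>; no coefficients other than integers are involved.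

  The reason is a unitriangular relation between the summands (\<open>power_sum_unitriangular\<close>):
  \<open>S\<^sub>d(s)\<close> is \<open>Si\<^sub>d(s)\<close> plus an integral combination of terms of weight \<open>s\<close> of the form \<open>Si\<^sub>d(t)\<close> times a
  nested sum of \<open>Si\<close> truncated at \<open>d\<close>, with \<open>t < s\<close>. Since \<open>Si\<^sub>d(s) Si\<^sub>d(t) = Si\<^sub>d(s + t)\<close>, products of nested
  sums of \<open>Si\<close> are integral combinations of such sums (\<open>nested_span_mult\<close>). So the relation can be
  substituted into a nested sum of \<open>S\<close>, and it can be inverted by induction on the weight and the
  leading exponent.

  The relation itself comes from the \<open>\<F>\<^sub>q\<close>-linear Carlitz polynomial \<open>E\<^sub>d\<close> that is \<open>0\<close> at the polynomials
  of degree less than \<open>d\<close> and \<open>1\<close> at the monic polynomials \<open>a\<close> of degree \<open>d\<close>. It satisfies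
  \<open>1 - E\<^sub>d(x) = \<Prod>(1 - x / a)\<close>, and its derivative is the constant \<open>1 / \<ell>\<^sub>d\<close>. Taking the logarithmic
  derivative gives the recursion \<open>S\<^sub>d(n + 1) = \<Sum>m=1..n. c\<^sub>m S\<^sub>d(n + 1 - m)\<close> for \<open>n \<ge> 1\<close>, where \<open>c\<^sub>m\<close> is
  the coefficient of \<open>x\<^sup>m\<close> in \<open>E\<^sub>d\<close> (\<open>power_sum_recursion\<close>). Finally
  \<open>E\<^sub>d(x) = (x / \<ell>\<^sub>d) \<Prod>j<d. (1 - E\<^sub>j(x)\<^sup>q\<^sup>-\<^sup>1)\<close> (\<open>carlitz_eq_prod\<close>), and expanding this product shows, by
  induction on \<open>m\<close>, that \<open>c\<^sub>m\<close> is \<open>Si\<^sub>d(1)\<close> times an integral combination of nested sums of \<open>Si\<close> of weight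
  \<open>m - 1\<close> (\<open>coeff_in_leading_span\<close>).
\<close>

section \<open>Integral spans\<close>

definition int_span :: "'a::comm_ring_1 set \<Rightarrow> 'a set"
  where "int_span = Modules.module.span (\<lambda>(n::int) x. of_int n * x)"

interpretation int_module: Modules.module "\<lambda>(n::int) (x::'a::comm_ring_1). of_int n * x"
  rewrites "Modules.module.span (\<lambda>(n::int) (x::'a::comm_ring_1). of_int n * x) = int_span"
  by unfold_locales (auto simp: algebra_simps int_span_def)

lemma additive_of_int_mult:
  fixes h :: "'a::comm_ring_1 \<Rightarrow> 'b::comm_ring_1"
  assumes "additive h"
  shows "h (of_int n * x) = of_int n * h x"
proof -
  interpret additive h by fact
  show ?thesis
    by (induction n rule: int_induct[where k = 0]) (simp_all add: zero add diff algebra_simps)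
qed

lemma additive_image_int_span:
  fixes h :: "'a::comm_ring_1 \<Rightarrow> 'b::comm_ring_1"
  assumes h: "additive h" and gen: "\<And>a. a \<in> A \<Longrightarrow> h a \<in> int_span B"
    and x: "x \<in> int_span A"
  shows "h x \<in> int_span B"
proof -
  interpret additive h by fact
  show ?thesis using x
  proof (induction rule: int_module.span_induct_alt)
    case base
    show ?case by (simp add: zero int_module.span_zero)
  next
    case (step c x y)
    hence "of_int c * h x + h y \<in> int_span B"
      using gen int_module.span_add int_module.span_scale by blast
    thus ?case by (simp add: add additive_of_int_mult[OF h])
  qed
qed

lemma int_span_mult:
  assumes "\<And>a b. a \<in> A \<Longrightarrow> b \<in> B \<Longrightarrow> a * b \<in> int_span C"
    and x: "x \<in> int_span A" and y: "y \<in> int_span B"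
  shows "x * y \<in> int_span C"
proof -
  have "a * y \<in> int_span C" if "a \<in> A" for a
    by (rule additive_image_int_span[OF _ _ y, of "\<lambda>y. a * y"])
       (use assms(1) that in \<open>auto simp: additive_def distrib_left\<close>)
  thus ?thesis
    by (intro additive_image_int_span[OF _ _ x, of "\<lambda>x. x * y"])
       (auto simp: additive_def distrib_right)
qed

section \<open>Nested sums\<close>

text \<open>
  Nested sums are treated as functions of the truncation: \<open>nested u [(e\<^sub>1, s\<^sub>1), \<dots>, (e\<^sub>n, s\<^sub>n)] d\<close> is the
  sum over \<open>d > d\<^sub>1 > \<dots> > d\<^sub>n \<ge> 0\<close> of the products of the \<open>e\<^sub>i ^ d\<^sub>i * u s\<^sub>i d\<^sub>i\<close>, and the same
  function before its outermost summation is \<open>leading u e\<^sub>1 s\<^sub>1 (nested u [(e\<^sub>2, s\<^sub>2), \<dots>])\<close>. Functions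
  are added and multiplied pointwise.
\<close>
definition partial_sums :: "(nat \<Rightarrow> 'a::comm_ring_1) \<Rightarrow> nat \<Rightarrow> 'a"
  where "partial_sums f d = (\<Sum>j<d. f j)"

definition leading :: "(nat \<Rightarrow> nat \<Rightarrow> 'a::comm_ring_1) \<Rightarrow> 'a \<Rightarrow> nat \<Rightarrow> (nat \<Rightarrow> 'a) \<Rightarrow> nat \<Rightarrow> 'a"
  where "leading u e s f d = e ^ d * u s d * f d"

fun nested :: "(nat \<Rightarrow> nat \<Rightarrow> 'a::comm_ring_1) \<Rightarrow> ('a \<times> nat) list \<Rightarrow> nat \<Rightarrow> 'a"
  where
    "nested u [] = 1"
  | "nested u ((e, s) # x) = partial_sums (leading u e s (nested u x))"

text \<open>
  The summand of the polylogarithms, for \<open>l d = 1 / \<ell>\<^sub>d\<close>. Among summands \<open>u\<close> it is singled out by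
  \<open>u s * u t = u (s + t)\<close>, which makes products of its nested sums integral combinations of nested
  sums.
\<close>
definition powers :: "(nat \<Rightarrow> 'a::comm_ring_1) \<Rightarrow> nat \<Rightarrow> nat \<Rightarrow> 'a"
  where "powers l s = l ^ s"

lemma power_fun_apply: "((f :: 'b \<Rightarrow> 'a::comm_ring_1) ^ n) x = f x ^ n"
  by (induction n) simp_all

lemma additive_partial_sums: "additive partial_sums"
  by (auto simp: additive_def partial_sums_def fun_eq_iff sum.distrib)

text \<open>
  A pair of indices below \<open>d\<close> has its first entry larger, its second entry larger, or both equal.
\<close>
lemma partial_sums_mult:
  "partial_sums f * partial_sums g =
     partial_sums (f * partial_sums g) + partial_sums (g * partial_sums f) + partial_sums (f * g)"
proof
  fix d
  show "(partial_sums f * partial_sums g) d =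
     (partial_sums (f * partial_sums g) + partial_sums (g * partial_sums f) + partial_sums (f * g)) d"
    by (induction d) (simp_all add: partial_sums_def algebra_simps)
qed

locale coefficient_monoid =
  fixes G :: "'a::comm_ring_1 set"
  assumes one_closed: "1 \<in> G"
    and mult_closed: "\<And>x y. x \<in> G \<Longrightarrow> y \<in> G \<Longrightarrow> x * y \<in> G"
begin

definition words :: "nat \<Rightarrow> ('a \<times> nat) list set"
  where "words w = {x. (\<forall>(e, s)\<in>set x. e \<in> G \<and> s \<ge> 1) \<and> sum_list (map snd x) = w}"

definition nested_span :: "(nat \<Rightarrow> nat \<Rightarrow> 'a) \<Rightarrow> nat \<Rightarrow> (nat \<Rightarrow> 'a) set"
  where "nested_span u w = int_span (nested u ` words w)"

abbreviation leading_generators :: "(nat \<Rightarrow> nat \<Rightarrow> 'a) \<Rightarrow> nat \<Rightarrow> nat \<Rightarrow> (nat \<Rightarrow> 'a) set"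
  where "leading_generators u b w \<equiv>
    {leading u e s (nested u x) |e s x. e \<in> G \<and> 1 \<le> s \<and> s \<le> b \<and> s \<le> w \<and> x \<in> words (w - s)}"

text \<open>
  The bound \<open>b\<close> on the leading exponent is what the inductions below run on. Under multiplication it
  behaves like a second weight, see \<open>leading_span_mult\<close>.
\<close>
definition leading_span :: "(nat \<Rightarrow> nat \<Rightarrow> 'a) \<Rightarrow> nat \<Rightarrow> nat \<Rightarrow> (nat \<Rightarrow> 'a) set"
  where "leading_span u b w = int_span (leading_generators u b w)"

lemma words_Cons_iff:
  "(e, s) # x \<in> words w \<longleftrightarrow> e \<in> G \<and> 1 \<le> s \<and> s \<le> w \<and> x \<in> words (w - s)"
  by (auto simp: words_def)

lemma words_0: "words 0 = {[]}"
proof -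
  have "x = []" if "x \<in> words 0" for x
    using that by (cases x) (auto simp: words_Cons_iff)
  thus ?thesis by (auto simp: words_def)
qed

text \<open>
  The empty word is the only one of weight \<open>0\<close>, so constants count as nested sums of weight \<open>0\<close>.
\<close>
lemma one_in_nested_span: "1 \<in> nested_span u 0"
  unfolding nested_span_def by (intro int_module.span_base) (auto simp: words_0)

lemma leading_in_leading_span:
  assumes "f \<in> nested_span u w" and e: "e \<in> G" "1 \<le> s" "s \<le> b"
  shows "leading u e s f \<in> leading_span u b (s + w)"
  using assms(1) unfolding nested_span_def leading_span_def
  by (rule additive_image_int_span[rotated 2])
     (use e in \<open>fastforce simp: additive_def leading_def fun_eq_iff distrib_left intro!: int_module.span_base\<close>)+

lemma partial_sums_in_nested_span:
  assumes "f \<in> leading_span u b w"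
  shows "partial_sums f \<in> nested_span u w"
  using assms unfolding leading_span_def nested_span_def
proof (rule additive_image_int_span[rotated 2])
  fix a assume "a \<in> leading_generators u b w"
  then obtain e s x where *: "a = leading u e s (nested u x)" "(e, s) # x \<in> words w"
    by (auto simp: words_Cons_iff)
  have "partial_sums a = nested u ((e, s) # x)" using * by simp
  thus "partial_sums a \<in> int_span (nested u ` words w)"
    using * by (intro int_module.span_base) blast
qed (rule additive_partial_sums)

lemma leading_span_mono: "b \<le> b' \<Longrightarrow> leading_span u b w \<subseteq> leading_span u b' w"
  unfolding leading_span_def by (rule int_module.span_mono) fastforce

text \<open>
  The factor \<open>e ^ d\<close> is absorbed by the root of unity of the leading letter; this is why roots of
  unity never interfere with the weight arguments.
\<close>
lemma twist_in_leading_span: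
  assumes "f \<in> leading_span u b w" and e: "e \<in> G"
  shows "(\<lambda>d. e ^ d) * f \<in> leading_span u b w"
  using assms(1) unfolding leading_span_def
proof (rule additive_image_int_span[rotated 2])
  fix a assume "a \<in> leading_generators u b w"
  then obtain e' s x where *: "a = leading u e' s (nested u x)" "e' \<in> G" "1 \<le> s \<and> s \<le> b \<and> s \<le> w \<and> x \<in> words (w - s)"
    by blast
  have "(\<lambda>d. e ^ d) * a = leading u (e * e') s (nested u x)"
    using * by (auto simp: leading_def fun_eq_iff power_mult_distrib)
  thus "(\<lambda>d. e ^ d) * a \<in> int_span (leading_generators u b w)"
    using * e mult_closed by (intro int_module.span_base) blast
qed (auto simp: additive_def algebra_simps)

text \<open>
  The quasi-shuffle product: by \<open>partial_sums_mult\<close> the product splits according to which of the two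
  outermost indices is larger, and when they agree the two leading letters merge into one.
\<close>
lemma nested_mult_nested:
  assumes "x \<in> words w" "y \<in> words w'"
  shows "nested (powers l) x * nested (powers l) y \<in> nested_span (powers l) (w + w')"
  using assms
proof (induction "length x + length y" arbitrary: x y w w' rule: less_induct)
  case less
  show ?case
  proof (cases "x = [] \<or> y = []")
    case True
    thus ?thesis using less.prems
      by (auto simp: words_def nested_span_def simp flip: one_fun_def intro!: int_module.span_base)
  next
    case False
    then obtain e s x' e' s' y' where xy: "x = (e, s) # x'" "y = (e', s') # y'"
      by (metis list.exhaust surj_pair)
    define P where "P = powers l"
    define f where "f = nested P x'"
    define g where "g = nested P y'"
    define F where "F = leading P e s f"
    define F' where "F' = leading P e' s' g"
    have w: "e \<in> G" "1 \<le> s" "s \<le> w" "x' \<in> words (w - s)"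
            "e' \<in> G" "1 \<le> s'" "s' \<le> w'" "y' \<in> words (w' - s')"
      using less.prems by (auto simp: xy words_Cons_iff)
    have nx: "nested P x = partial_sums F" "nested P y = partial_sums F'"
      by (simp_all add: xy F_def F'_def f_def g_def)
    have "f * nested P y \<in> nested_span P (w - s + w')"
      unfolding f_def P_def using less.prems w xy by (intro less.hyps) auto
    hence "leading P e s (f * nested P y) \<in> leading_span P s (s + (w - s + w'))"
      using w by (intro leading_in_leading_span) auto
    also have "leading P e s (f * nested P y) = F * nested P y"
      by (auto simp: F_def leading_def fun_eq_iff)
    also have "s + (w - s + w') = w + w'" using w by simp
    finally have 1: "partial_sums (F * nested P y) \<in> nested_span P (w + w')"
      by (rule partial_sums_in_nested_span)
    have "g * nested P x \<in> nested_span P (w' - s' + w)"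
      unfolding g_def P_def using less.prems w xy by (intro less.hyps) auto
    hence "leading P e' s' (g * nested P x) \<in> leading_span P s' (s' + (w' - s' + w))"
      using w by (intro leading_in_leading_span) auto
    also have "leading P e' s' (g * nested P x) = F' * nested P x"
      by (auto simp: F'_def leading_def fun_eq_iff)
    also have "s' + (w' - s' + w) = w + w'" using w by simp
    finally have 2: "partial_sums (F' * nested P x) \<in> nested_span P (w + w')"
      by (rule partial_sums_in_nested_span)
    have "f * g \<in> nested_span P (w - s + (w' - s'))"
      unfolding f_def g_def P_def using less.prems w xy by (intro less.hyps) auto
    hence "leading P (e * e') (s + s') (f * g) \<in> leading_span P (s + s') (s + s' + (w - s + (w' - s')))"
      using w mult_closed by (intro leading_in_leading_span) auto
    also have "leading P (e * e') (s + s') (f * g) = F * F'"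
      by (auto simp: F_def F'_def P_def powers_def leading_def fun_eq_iff power_fun_apply power_mult_distrib power_add)
    also have "s + s' + (w - s + (w' - s')) = w + w'" using w by simp
    finally have 3: "partial_sums (F * F') \<in> nested_span P (w + w')"
      by (rule partial_sums_in_nested_span)
    have "nested P x * nested P y =
       partial_sums (F * nested P y) + partial_sums (F' * nested P x) + partial_sums (F * F')"
      unfolding nx by (rule partial_sums_mult)
    also have "\<dots> \<in> nested_span P (w + w')"
      using 1 2 3 unfolding nested_span_def by (intro int_module.span_add)
    finally show ?thesis by (simp add: P_def)
  qed
qed

lemma nested_span_mult:
  assumes "f \<in> nested_span (powers l) w" "g \<in> nested_span (powers l) w'"
  shows "f * g \<in> nested_span (powers l) (w + w')"
  using assms nested_mult_nested unfolding nested_span_def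
  by (blast intro: int_span_mult[where A = "nested (powers l) ` words w" and B = "nested (powers l) ` words w'"])

lemma leading_span_mult_nested_span:
  assumes "f \<in> leading_span (powers l) b w" "g \<in> nested_span (powers l) w'"
  shows "f * g \<in> leading_span (powers l) b (w + w')"
  using assms(1) unfolding leading_span_def
proof (rule additive_image_int_span[rotated 2])
  fix a assume "a \<in> leading_generators (powers l) b w"
  then obtain e s x where *: "a = leading (powers l) e s (nested (powers l) x)" "e \<in> G" 
      "1 \<le> s" "s \<le> b" "s \<le> w" "x \<in> words (w - s)"
    by blast
  have "nested (powers l) x \<in> nested_span (powers l) (w - s)"
    unfolding nested_span_def using * by (intro int_module.span_base) auto
  hence "nested (powers l) x * g \<in> nested_span (powers l) (w - s + w')"
    using assms(2) nested_span_mult by blast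
  hence "leading (powers l) e s (nested (powers l) x * g) \<in> leading_span (powers l) b (s + (w - s + w'))"
    using * by (intro leading_in_leading_span) auto
  also have "leading (powers l) e s (nested (powers l) x * g) = a * g"
    using * by (auto simp: leading_def fun_eq_iff)
  also have "s + (w - s + w') = w + w'" using * by simp
  finally show "a * g \<in> int_span (leading_generators (powers l) b (w + w'))"
    unfolding leading_span_def .
qed (auto simp: additive_def algebra_simps)

lemma leading_span_mult:
  assumes "f \<in> leading_span (powers l) b w" "g \<in> leading_span (powers l) b' w'"
  shows "f * g \<in> leading_span (powers l) (b + b') (w + w')"
  using assms unfolding leading_span_def
proof (rule int_span_mult[rotated 1])
  fix f g 
  assume "f \<in> leading_generators (powers l) b w"
    and "g \<in> leading_generators (powers l) b' w'"
  then obtain e s x e' s' x' where 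
    *: "f = leading (powers l) e s (nested (powers l) x)" "e \<in> G" "1 \<le> s" "s \<le> b" "s \<le> w" "x \<in> words (w - s)"
       "g = leading (powers l) e' s' (nested (powers l) x')" "e' \<in> G" "1 \<le> s'" "s' \<le> b'" "s' \<le> w'" "x' \<in> words (w' - s')"
    by blast
  have "nested (powers l) x * nested (powers l) x' \<in> nested_span (powers l) (w - s + (w' - s'))"
    using * by (intro nested_mult_nested)
  hence "leading (powers l) (e * e') (s + s') (nested (powers l) x * nested (powers l) x')
      \<in> leading_span (powers l) (b + b') (s + s' + (w - s + (w' - s')))"
    using * mult_closed by (intro leading_in_leading_span) auto
  also have "leading (powers l) (e * e') (s + s') (nested (powers l) x * nested (powers l) x') = f * g"
    by (auto simp: * powers_def leading_def fun_eq_iff power_fun_apply power_mult_distrib power_add)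
  also have "s + s' + (w - s + (w' - s')) = w + w'" using * by simp
  finally show "f * g \<in> int_span (leading_generators (powers l) (b + b') (w + w'))"
    unfolding leading_span_def .
qed

lemma powers_in_leading_span:
  assumes "1 \<le> s" "s \<le> b"
  shows "powers l s \<in> leading_span (powers l) b s"
proof -
  have "leading (powers l) 1 s 1 \<in> leading_span (powers l) b (s + 0)"
    using assms one_closed by (intro leading_in_leading_span one_in_nested_span)
  also have "leading (powers l) 1 s 1 = powers l s"
    by (auto simp: leading_def fun_eq_iff)
  finally show ?thesis by simp
qed

section \<open>Unitriangular changes of summand\<close>

text \<open>
  Replacing one summand \<open>v s\<close> by \<open>powers l s\<close> costs an error in \<open>leading_span\<close>, and the product of this
  error with the remaining nested sum is again an integral combination of nested sums by the
  quasi-shuffle product.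
\<close>
lemma nested_span_subset_of_unitriangular:
  assumes tri: "\<And>s. s \<ge> 1 \<Longrightarrow> v s - powers l s \<in> leading_span (powers l) (s - 1) s"
  shows "nested_span v w \<subseteq> nested_span (powers l) w"
proof -
  have "nested v x \<in> nested_span (powers l) w" if "x \<in> words w" for x
    using that
  proof (induction x arbitrary: w)
    case Nil
    thus ?case using one_in_nested_span by (auto simp: words_def simp flip: one_fun_def)
  next
    case (Cons a x)
    obtain e s where a: "a = (e, s)" by force
    have w: "e \<in> G" "1 \<le> s" "s \<le> w" "x \<in> words (w - s)"
      using Cons.prems by (auto simp: a words_Cons_iff)
    define f where "f = nested v x"
    define R where "R = v s - powers l s"
    have f: "f \<in> nested_span (powers l) (w - s)" unfolding f_def using Cons.IH w by blast
    have "R * f \<in> leading_span (powers l) (s - 1) (s + (w - s))"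
      unfolding R_def using f tri w by (intro leading_span_mult_nested_span) auto
    hence "(\<lambda>d. e ^ d) * (R * f) \<in> leading_span (powers l) s (s + (w - s))"
      using leading_span_mono[of "s - 1" s] w by (intro twist_in_leading_span) auto
    moreover have "leading (powers l) e s f \<in> leading_span (powers l) s (s + (w - s))"
      using f w by (intro leading_in_leading_span) auto
    ultimately have "leading (powers l) e s f + (\<lambda>d. e ^ d) * (R * f) \<in> leading_span (powers l) s w"
      using w unfolding leading_span_def by (simp add: int_module.span_add)
    also have "leading (powers l) e s f + (\<lambda>d. e ^ d) * (R * f) = leading v e s f"
      by (auto simp: leading_def R_def fun_eq_iff algebra_simps)
    finally show ?case
      using partial_sums_in_nested_span by (simp add: a f_def)
  qed
  thus ?thesis unfolding nested_span_def
    by (intro int_module.span_minimal) auto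
qed

text \<open>
  There is no product formula for nested sums of \<open>v\<close> to rely on. Instead, in \<open>powers l s = v s - (v s - powers l s)\<close>
  the first term is multiplied by a nested sum of smaller weight, which is already known to come
  from \<open>v\<close>, and the second has leading exponent less than \<open>s\<close>. Hence the induction on the weight and,
  inside it, on the leading exponent.
\<close>
lemma nested_span_supset_of_unitriangular:
  assumes tri: "\<And>s. s \<ge> 1 \<Longrightarrow> v s - powers l s \<in> leading_span (powers l) (s - 1) s"
  shows "nested_span (powers l) w \<subseteq> nested_span v w"
proof (induction w rule: less_induct)
  case (less w)
  have lead: "leading_span (powers l) b w \<subseteq> leading_span v w w" for b
  proof (induction b rule: less_induct)
    case (less b)
    have "leading (powers l) e s (nested (powers l) x) \<in> leading_span v w w"
      if *: "e \<in> G" "1 \<le> s" "s \<le> b" "s \<le> w" "x \<in> words (w - s)" for e s x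
    proof -
      define f where "f = nested (powers l) x"
      define R where "R = v s - powers l s"
      have f: "f \<in> nested_span (powers l) (w - s)" 
        unfolding f_def nested_span_def using * by (intro int_module.span_base) auto
      hence fv: "f \<in> nested_span v (w - s)"
        using * \<open>\<And>y. y < w \<Longrightarrow> nested_span (powers l) y \<subseteq> nested_span v y\<close>[of "w - s"] by auto
      have "R * f \<in> leading_span (powers l) (s - 1) (s + (w - s))"
        unfolding R_def using f tri * by (intro leading_span_mult_nested_span) auto
      hence "(\<lambda>d. e ^ d) * (R * f) \<in> leading_span (powers l) (s - 1) w"
        using * by (intro twist_in_leading_span) auto
      hence "(\<lambda>d. e ^ d) * (R * f) \<in> leading_span v w w"
        using less.IH[of "s - 1"] * by (meson diff_less less_le_trans less_numeral_extra(1) subsetD zero_less_one)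
      moreover have "leading v e s f \<in> leading_span v w (s + (w - s))"
        using fv * by (intro leading_in_leading_span) auto
      ultimately have "leading v e s f - (\<lambda>d. e ^ d) * (R * f) \<in> leading_span v w w"
        using * unfolding leading_span_def by (simp add: int_module.span_diff)
      also have "leading v e s f - (\<lambda>d. e ^ d) * (R * f) = leading (powers l) e s f"
        by (auto simp: leading_def R_def fun_eq_iff algebra_simps)
      finally show ?thesis by (simp add: f_def)
    qed
    thus ?case unfolding leading_span_def[of "powers l"]
      by (intro int_module.span_minimal) (auto simp: leading_span_def)
  qed
  have "nested (powers l) x \<in> nested_span v w" if "x \<in> words w" for x
  proof (cases x)
    case Nil
    thus ?thesis using that one_in_nested_span by (auto simp: words_def simp flip: one_fun_def)
  next
    case (Cons a y)
    obtain e s where a: "a = (e, s)" by force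
    have w: "e \<in> G" "1 \<le> s" "s \<le> w" "y \<in> words (w - s)"
      using that by (auto simp: a Cons words_Cons_iff)
    have "leading (powers l) e s (nested (powers l) y) \<in> leading_span (powers l) w w"
      unfolding leading_span_def using w by (intro int_module.span_base) auto
    thus ?thesis using lead partial_sums_in_nested_span by (fastforce simp: a Cons)
  qed
  thus ?case unfolding nested_span_def[of "powers l"]
    by (intro int_module.span_minimal) (auto simp: nested_span_def)
qed

text \<open>
  The term \<open>m = 1\<close> of the recursion multiplies \<open>v n\<close> by \<open>l\<close> and so produces the diagonal entry
  \<open>powers l (Suc n)\<close>. For \<open>m \<ge> 2\<close> the leading exponent is at most \<open>1 + (Suc n - m) \<le> n\<close>, because the
  coefficient \<open>c m\<close> contributes only \<open>1\<close> to it although its weight is \<open>m\<close>.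
\<close>
lemma unitriangular_of_recursion:
  assumes c: "\<And>m. m \<ge> 1 \<Longrightarrow> c m \<in> leading_span (powers l) 1 m" and c1: "c 1 = l"
    and v: "\<And>n. v (Suc n) = (if n = 0 then l else 0) + (\<Sum>m=1..n. c m * v (Suc n - m))"
    and "s \<ge> 1"
  shows "v s - powers l s \<in> leading_span (powers l) (s - 1) s"
  using \<open>s \<ge> 1\<close>
proof (induction s rule: less_induct)
  case (less s)
  then obtain n where n: "s = Suc n" by (cases s) auto
  show ?case
  proof (cases "n = 0")
    case True
    hence "v s - powers l s = 0" using v[of 0] n by (simp add: powers_def)
    thus ?thesis unfolding leading_span_def by (simp only: int_module.span_zero)
  next
    case False
    define R where "R = v n - powers l n"
    have R: "R \<in> leading_span (powers l) (n - 1) n" unfolding R_def using False n by (intro less.IH) auto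
    have vn: "v n = powers l n + R" by (simp add: R_def)
    have "l * R \<in> leading_span (powers l) (1 + (n - 1)) (1 + n)"
      using R powers_in_leading_span[of 1 1 l] by (intro leading_span_mult) (auto simp: powers_def)
    hence 1: "l * R \<in> leading_span (powers l) n s" using False n by simp
    have 2: "c m * v (Suc n - m) \<in> leading_span (powers l) n s" if m: "m \<in> {2..n}" for m
    proof -
      define k where "k = Suc n - m"
      have k: "1 \<le> k" "k < n" "m + k = s" using m n by (auto simp: k_def)
      have "v k - powers l k \<in> leading_span (powers l) k k"
        using less.IH[of k] k n leading_span_mono[of "k - 1" k "powers l" k] by fastforce
      moreover have "powers l k \<in> leading_span (powers l) k k"
        using k by (intro powers_in_leading_span) auto
      ultimately have "(v k - powers l k) + powers l k \<in> leading_span (powers l) k k"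
        unfolding leading_span_def by (rule int_module.span_add)
      hence "c m * v k \<in> leading_span (powers l) (1 + k) (m + k)"
        using c[of m] m by (intro leading_span_mult) auto
      thus ?thesis using k leading_span_mono[of "1 + k" n "powers l" s] by (auto simp: k_def)
    qed
    have "{1..n} = insert 1 {2..n}" using False by auto
    hence "v s = l * v n + (\<Sum>m\<in>{2..n}. c m * v (Suc n - m))"
      using v[of n] False n c1 by simp
    hence "v s - powers l s = l * R + (\<Sum>m\<in>{2..n}. c m * v (Suc n - m))"
      by (simp add: vn powers_def n algebra_simps)
    also have "\<dots> \<in> leading_span (powers l) n s"
      using 1 2 unfolding leading_span_def by (intro int_module.span_add int_module.span_sum)
    finally show ?thesis by (simp only: n diff_Suc_1)
  qed
qed

text \<open>
  Without constant terms, the coefficient of \<open>x\<^sup>m\<close> in a power involves only coefficients of index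
  between \<open>1\<close> and \<open>m\<close>, whose indices add up to \<open>m\<close>.
\<close>
lemma coeff_power_in_leading_span:
  fixes E :: "nat \<Rightarrow> 'a poly"
  assumes E: "\<And>m. 1 \<le> m \<Longrightarrow> m \<le> n \<Longrightarrow> (\<lambda>d. coeff (E d) m) \<in> leading_span (powers l) m m"
    and E0: "\<And>d. coeff (E d) 0 = 0" and "k \<ge> 1" "m \<ge> 1" "m \<le> n"
  shows "(\<lambda>d. coeff (E d ^ k) m) \<in> leading_span (powers l) m m"
  using \<open>k \<ge> 1\<close> \<open>m \<ge> 1\<close> \<open>m \<le> n\<close>
proof (induction k arbitrary: m rule: dec_induct)
  case base
  thus ?case using E by simp
next
  case (step k)
  have Ek0: "coeff (E d ^ k) 0 = 0" for d
    using E0 step.hyps by (simp add: coeff_0_power power_0_left)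
  have eq: "(\<lambda>d. coeff (E d ^ Suc k) m) = 
      (\<Sum>i\<in>{1..<m}. (\<lambda>d. coeff (E d) i) * (\<lambda>d. coeff (E d ^ k) (m - i)))"
  proof
    fix d
    have "coeff (E d ^ Suc k) m = (\<Sum>i\<le>m. coeff (E d) i * coeff (E d ^ k) (m - i))"
      by (simp add: coeff_mult)
    also have "\<dots> = (\<Sum>i\<in>{1..<m}. coeff (E d) i * coeff (E d ^ k) (m - i))"
    proof (rule sum.mono_neutral_right)
      show "\<forall>i\<in>{..m} - {1..<m}. coeff (E d) i * coeff (E d ^ k) (m - i) = 0"
      proof
        fix i assume "i \<in> {..m} - {1..<m}"
        hence "i = 0 \<or> i = m" by auto
        thus "coeff (E d) i * coeff (E d ^ k) (m - i) = 0" using E0 Ek0 by auto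
      qed
    qed auto
    also have "\<dots> = (\<Sum>i\<in>{1..<m}. (\<lambda>d. coeff (E d) i) * (\<lambda>d. coeff (E d ^ k) (m - i))) d"
      by (induction rule: infinite_finite_induct) simp_all
    finally show "coeff (E d ^ Suc k) m = \<dots>" .
  qed
  have "(\<lambda>d. coeff (E d) i) * (\<lambda>d. coeff (E d ^ k) (m - i)) \<in> leading_span (powers l) m m"
    if i: "i \<in> {1..<m}" for i
  proof -
    have "(\<lambda>d. coeff (E d) i) * (\<lambda>d. coeff (E d ^ k) (m - i)) \<in> leading_span (powers l) (i + (m - i)) (i + (m - i))"
      using i step.prems by (intro leading_span_mult step.IH E) auto
    thus ?thesis using i by simp
  qed
  thus ?case unfolding eq unfolding leading_span_def by (intro int_module.span_sum)
qed

text \<open>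
  The factor \<open>l d\<close> supplies the leading letter of exponent \<open>1\<close>, and the coefficient of \<open>x\<^sup>m\<close> of \<open>E d\<close> is
  \<open>l d\<close> times that of \<open>x\<^sup>m\<^sup>-\<^sup>1\<close> in \<open>\<Prod>j<d. 1 - E j ^ k\<close>. The latter is a nested sum: telescoping the
  product over \<open>j\<close> gives a sum over \<open>j < d\<close> of coefficients of \<open>E j ^ k\<close>, which have smaller index
  than \<open>m\<close>, times coefficients of the truncated product.
\<close>
lemma coeff_in_leading_span:
  fixes E :: "nat \<Rightarrow> 'a poly"
  assumes E: "\<And>d. E d = smult (l d) ([:0, 1:] * (\<Prod>j<d. 1 - E j ^ k))" and k: "k \<ge> 1"
    and "m \<ge> 1"
  shows "(\<lambda>d. coeff (E d) m) \<in> leading_span (powers l) 1 m"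
  using \<open>m \<ge> 1\<close>
proof (induction m rule: less_induct)
  case (less m)
  define H where "H d = (\<Prod>j<d. 1 - E j ^ k)" for d
  have E0: "coeff (E d) 0 = 0" for d by (subst E) simp
  have E': "coeff (E d) (Suc i) = l d * coeff (H d) i" for d i
    by (subst E) (simp add: H_def)
  have pow: "(\<lambda>d. coeff (E d ^ k) i) \<in> leading_span (powers l) i i" if "1 \<le> i" "i < m" for i
  proof (rule coeff_power_in_leading_span[where n = "m - 1"])
    fix i assume "1 \<le> i" "i \<le> m - 1"
    thus "(\<lambda>d. coeff (E d) i) \<in> leading_span (powers l) i i"
      using less.IH[of i] leading_span_mono[of 1 i "powers l" i] by auto
  qed (use E0 k that in auto)
  have Ek0: "coeff (E d ^ k) 0 = 0" for d
    using E0 k by (simp add: coeff_0_power power_0_left)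
  have H: "(\<lambda>d. coeff (H d) i) \<in> nested_span (powers l) i" if "i < m" for i
    using that
  proof (induction i rule: less_induct)
    case (less i)
    define g where "g j = (\<lambda>d. coeff (E d ^ k) j) * (\<lambda>d. coeff (H d) (i - j))" for j
    have g: "g j \<in> leading_span (powers l) i i" if j: "j \<in> {1..i}" for j
    proof -
      have "g j \<in> leading_span (powers l) j (j + (i - j))"
        unfolding g_def using j less.prems by (intro leading_span_mult_nested_span pow less.IH) auto
      thus ?thesis using j leading_span_mono[of j i] by auto
    qed
    \<comment> \<open>The telescoped product.\<close>
    have Heq: "H d = 1 - (\<Sum>j<d. E j ^ k * H j)" for d
      by (induction d) (simp_all add: H_def algebra_simps)
    have "(\<lambda>d. coeff (H d) i) = (if i = 0 then 1 else 0) - partial_sums (\<Sum>j\<in>{1..i}. g j)"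
    proof
      fix d
      have "coeff (H d) i = coeff 1 i - (\<Sum>j<d. coeff (E j ^ k * H j) i)"
        by (subst Heq) (simp add: coeff_sum)
      also have "(\<Sum>j<d. coeff (E j ^ k * H j) i) = partial_sums (\<Sum>j\<in>{1..i}. g j) d"
        unfolding partial_sums_def
      proof (rule sum.cong[OF refl])
        fix d'
        have "coeff (E d' ^ k * H d') i = (\<Sum>j\<le>i. g j d')"
          by (simp add: coeff_mult g_def)
        also have "\<dots> = (\<Sum>j\<in>{1..i}. g j d')"
        proof (rule sum.mono_neutral_right)
          show "\<forall>j\<in>{..i} - {1..i}. g j d' = 0"
          proof
            fix j assume "j \<in> {..i} - {1..i}"
            hence "j = 0" by auto
            thus "g j d' = 0" by (simp add: g_def Ek0)
          qed
        qed auto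
        also have "\<dots> = (\<Sum>j\<in>{1..i}. g j) d'"
          by (induction rule: infinite_finite_induct) simp_all
        finally show "coeff (E d' ^ k * H d') i = (\<Sum>j\<in>{1..i}. g j) d'" .
      qed
      finally show "coeff (H d) i = ((if i = 0 then 1 else 0) - partial_sums (\<Sum>j\<in>{1..i}. g j)) d"
        by simp
    qed
    also have "\<dots> \<in> nested_span (powers l) i"
    proof -
      have "(\<Sum>j\<in>{1..i}. g j) \<in> leading_span (powers l) i i"
        using g unfolding leading_span_def by (intro int_module.span_sum)
      hence "partial_sums (\<Sum>j\<in>{1..i}. g j) \<in> nested_span (powers l) i"
        by (rule partial_sums_in_nested_span)
      moreover have "(if i = 0 then 1 else 0) \<in> nested_span (powers l) i"
        using one_in_nested_span by (auto simp: nested_span_def int_module.span_zero)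
      ultimately show ?thesis unfolding nested_span_def by (intro int_module.span_diff)
    qed
    finally show ?case .
  qed
  obtain n where n: "m = Suc n" using less.prems by (cases m) auto
  have "leading (powers l) 1 1 (\<lambda>d. coeff (H d) n) \<in> leading_span (powers l) 1 (1 + n)"
    using one_closed H n by (intro leading_in_leading_span) auto
  also have "leading (powers l) 1 1 (\<lambda>d. coeff (H d) n) = (\<lambda>d. coeff (E d) m)"
    by (auto simp: leading_def powers_def n E' fun_eq_iff)
  finally show ?case by (simp add: n)
qed

end

section \<open>The Frobenius map\<close>

lemma CARD_field_gt_1: "CARD('k::{finite,field}) > 1"
proof -
  have "card {0, 1 :: 'k} \<le> CARD('k)" by (intro card_mono) auto
  thus ?thesis by simp
qed

lemma finite_field_power_card: "(c::'k::{finite,field}) ^ CARD('k) = c"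
proof (cases "c = 0")
  case True
  thus ?thesis using CARD_field_gt_1[where 'k = 'k] by (simp add: power_0_left)
next
  case False
  let ?S = "UNIV - {0::'k}"
  have "(\<Prod>x\<in>?S. x) = (\<Prod>x\<in>?S. c * x)"
    by (rule prod.reindex_bij_witness[of _ "\<lambda>x. c * x" "\<lambda>x. x / c"]) (use False in auto)
  also have "\<dots> = c ^ card ?S * (\<Prod>x\<in>?S. x)" by (simp add: prod.distrib)
  finally have "c ^ card ?S = 1" by simp
  moreover have "CARD('k) = Suc (card ?S)"
    using CARD_field_gt_1[where 'k = 'k] by (simp add: card_Diff_singleton)
  ultimately show ?thesis by (simp only: power_Suc mult_1_right)
qed

lemma of_nat_CARD_eq_0: "(of_nat CARD('k) :: 'k::{finite,field}) = 0"
proof -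
  have "(\<Sum>x\<in>UNIV. x :: 'k) = (\<Sum>x\<in>UNIV. x + 1)"
    by (rule sum.reindex_bij_witness[of _ "\<lambda>x. x + 1" "\<lambda>x. x - 1"]) auto
  thus ?thesis by (simp add: sum.distrib)
qed

text \<open>
  The polynomial \<open>(x + 1) ^ q - x ^ q - 1\<close> vanishes on all \<open>q\<close> elements of the field and has degree less
  than \<open>q\<close>. This gives additivity of the \<open>q\<close>-power map for any \<open>q = CARD('k)\<close> directly, without writing
  \<open>q\<close> as a power of the characteristic.
\<close>
lemma of_nat_CARD_choose_eq_0:
  assumes "0 < i" "i < CARD('k)"
  shows "(of_nat (CARD('k) choose i) :: 'k::{finite,field}) = 0"
proof -
  let ?q = "CARD('k)"
  define p :: "'k poly" where "p = (\<Sum>j\<in>{1..<?q}. monom (of_nat (?q choose j)) j)"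
  have q: "?q > 1" by (rule CARD_field_gt_1)
  have "poly p c = 0" for c
  proof -
    have "c + 1 = (c + 1) ^ ?q" by (simp add: finite_field_power_card)
    also have "\<dots> = (\<Sum>j\<le>?q. of_nat (?q choose j) * c ^ j)"
      by (simp add: binomial_ring)
    also have "{..?q} = insert 0 (insert ?q {1..<?q})" using q by auto
    also have "(\<Sum>j\<in>\<dots>. of_nat (?q choose j) * c ^ j) = 1 + (c ^ ?q + poly p c)"
      using q by (simp add: p_def poly_sum poly_monom)
    finally show ?thesis by (simp add: finite_field_power_card)
  qed
  hence roots: "{c. poly p c = 0} = UNIV" by auto
  have "degree p \<le> ?q - 1"
    unfolding p_def by (intro degree_sum_le order.trans[OF degree_monom_le]) auto
  hence "p = 0"
    using q roots card_poly_roots_bound[of p] by (cases "p = 0") auto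
  hence "coeff p i = 0" by simp
  thus ?thesis using assms by (simp add: p_def coeff_sum)
qed

lemma frobenius_add:
  fixes x y :: "'k::{finite,field} alg_closure fls"
  shows "(x + y) ^ CARD('k) = x ^ CARD('k) + y ^ CARD('k)"
proof -
  let ?q = "CARD('k)"
  have q: "?q > 1" by (rule CARD_field_gt_1)
  have 0: "(of_nat (?q choose j) :: 'k alg_closure fls) = 0" if "j \<in> {1..<?q}" for j
  proof -
    have "(of_nat (?q choose j) :: 'k alg_closure) = to_ac (of_nat (?q choose j))"
      by simp
    also have "\<dots> = 0" using of_nat_CARD_choose_eq_0[of j, where 'k = 'k] that by (simp del: to_ac_of_nat)
    finally show ?thesis by (simp add: fls_of_nat)
  qed
  have "(x + y) ^ ?q = (\<Sum>j\<le>?q. of_nat (?q choose j) * x ^ j * y ^ (?q - j))"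
    by (rule binomial_ring)
  also have "{..?q} = insert 0 (insert ?q {1..<?q})" using q by auto
  also have "(\<Sum>j\<in>\<dots>. of_nat (?q choose j) * x ^ j * y ^ (?q - j)) = y ^ ?q + (x ^ ?q + 0)"
    using q 0 by simp
  finally show ?thesis by simp
qed

lemma frobenius_diff:
  fixes x y :: "'k::{finite,field} alg_closure fls"
  shows "(x - y) ^ CARD('k) = x ^ CARD('k) - y ^ CARD('k)"
  using frobenius_add[of "x - y" y] by (simp only: diff_add_cancel add_diff_cancel_right')

lemma of_nat_CARD_fls_eq_0: "(of_nat CARD('k) :: 'k::{finite,field} alg_closure fls) = 0"
proof -
  have "(of_nat CARD('k) :: 'k alg_closure) = to_ac (of_nat CARD('k))" by simp
  also have "\<dots> = 0" by (simp only: of_nat_CARD_eq_0 to_ac_0)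
  finally show ?thesis by (simp add: fls_of_nat)
qed

section \<open>The embedding of polynomials into Laurent series\<close>

lemma emb_eq_sum: "emb a = (\<Sum>i\<le>degree a. fls_const (to_ac (coeff a i)) * theta ^ i)"
proof -
  have "degree (map_poly (\<lambda>c. fls_const (to_ac c)) a) = degree a"
    by (rule degree_map_poly) auto
  thus ?thesis by (simp add: emb_def poly_altdef coeff_map_poly)
qed

lemma emb_pCons: "emb (pCons c a) = fls_const (to_ac c) + theta * emb a"
  by (simp add: emb_def map_poly_pCons)

lemma emb_add: "emb (a + b) = emb a + emb b"
  by (rule fls_eqI) (simp add: emb_nth)

lemma emb_diff: "emb (a - b) = emb a - emb b"
  by (rule fls_eqI) (simp add: emb_nth)

lemma emb_smult: "emb (smult c a) = fls_const (to_ac c) * emb a"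
  by (rule fls_eqI) (simp add: emb_nth)

lemma emb_mult: "emb (a * b) = emb a * emb b"
  by (induction a) (simp_all add: emb_pCons emb_add emb_smult algebra_simps)

lemma emb_1: "emb 1 = 1"
  by (simp add: one_pCons emb_pCons)

lemma emb_monom: "emb (monom 1 n) = theta ^ n"
  by (induction n) (simp_all add: monom_0 monom_Suc emb_pCons)

text \<open>
  Carlitz's \<open>[d] = \<theta>\<^bsup>q\<^sup>d\<^esup> - \<theta>\<close>, so that \<open>\<ell>\<^sub>d = (-1)\<^sup>d [1] \<cdots> [d]\<close>. The type argument carries the base field.
\<close>
definition bracket :: "'k::{finite,field} itself \<Rightarrow> nat \<Rightarrow> 'k alg_closure fls"
  where "bracket _ d = theta ^ (CARD('k) ^ d) - theta"

lemma emb_ell_Suc: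
  "emb (ell (Suc d) :: 'k::{finite,field} poly) = - bracket TYPE('k) (Suc d) * emb (ell d :: 'k poly)"
proof -
  have "ell (Suc d) = ell d * (monom 1 1 - monom (1 :: 'k) (CARD('k) ^ Suc d))"
    unfolding ell_def by simp
  thus ?thesis by (simp only: emb_mult emb_diff emb_monom bracket_def) (simp only: power_one_right minus_diff_eq mult.commute)
qed

lemma bracket_nonzero: "bracket TYPE('k::{finite,field}) (Suc d) \<noteq> 0"
proof
  assume "bracket TYPE('k) (Suc d) = 0"
  hence "emb (ell (Suc d) :: 'k poly) = 0" by (simp add: emb_ell_Suc del: emb_eq_0_iff)
  thus False using ell_nonzero[of "Suc d", where 'k = 'k] by simp
qed

lemma bracket_Suc:
  "bracket TYPE('k::{finite,field}) (Suc d) = bracket TYPE('k) d ^ CARD('k) + bracket TYPE('k) 1"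
proof -
  have "theta ^ (CARD('k) ^ Suc d) = (theta ^ (CARD('k) ^ d)) ^ CARD('k)"
    by (simp only: power_Suc2 power_mult)
  thus ?thesis by (simp only: bracket_def frobenius_diff power_one_right) simp
qed

section \<open>Normalised Carlitz polynomials\<close>

text \<open>
  \<open>carlitz d\<close> is \<open>e\<^sub>d / D\<^sub>d\<close> in Carlitz's notation, where \<open>e\<^sub>d = \<Prod>(x - a)\<close> over all \<open>a\<close> of degree less than
  \<open>d\<close>, and \<open>D\<^sub>d = e\<^sub>d(\<theta>\<^sup>d)\<close> is the product of the monic polynomials of degree \<open>d\<close>. The recursion is
  Carlitz's \<open>e\<^bsub>d+1\<^esub> = e\<^sub>d ^ q - D\<^sub>d ^ (q - 1) * e\<^sub>d\<close> after division by \<open>D\<^bsub>d+1\<^esub> = [d+1] D\<^sub>d ^ q\<close>. Taken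
  as the definition, it gives linearity at once, and the values at polynomials are recovered from
  \<open>poly_carlitz_theta\<close>.
\<close>
primrec carlitz :: "nat \<Rightarrow> 'k::{finite,field} alg_closure fls poly"
  where
    "carlitz 0 = [:0, 1:]"
  | "carlitz (Suc d) = smult (1 / bracket TYPE('k) (Suc d)) (carlitz d ^ CARD('k) - carlitz d)"

lemma poly_carlitz_Suc:
  fixes x :: "'k::{finite,field} alg_closure fls"
  shows "poly (carlitz (Suc d)) x * bracket TYPE('k) (Suc d) =
    poly (carlitz d) x ^ CARD('k) - poly (carlitz d) x"
  using bracket_nonzero[of d, where 'k = 'k] by simp

lemma poly_carlitz_add:
  fixes x y :: "'k::{finite,field} alg_closure fls"
  shows "poly (carlitz d) (x + y) = poly (carlitz d) x + poly (carlitz d) y"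
  by (induction d) (simp_all add: frobenius_add add_divide_distrib diff_divide_distrib)

lemma poly_carlitz_scale:
  fixes x :: "'k::{finite,field} alg_closure fls"
  shows "poly (carlitz d) (fls_const (to_ac c) * x) = fls_const (to_ac c) * poly (carlitz d) x"
proof (induction d)
  case (Suc d)
  have c: "fls_const (to_ac c) ^ CARD('k) = fls_const (to_ac c)"
    by (simp only: finite_field_power_card flip: fls_const_power to_ac_power)
  show ?case by (simp add: Suc c power_mult_distrib diff_divide_distrib right_diff_distrib)
qed simp

lemma poly_carlitz_0 [simp]: "poly (carlitz d) 0 = (0 :: 'k::{finite,field} alg_closure fls)"
  using poly_carlitz_add[of d 0 0] by (metis add_0 add_cancel_right_left)

lemma poly_carlitz_sum:
  "poly (carlitz d) (\<Sum>i\<in>I. f i) = (\<Sum>i\<in>I. poly (carlitz d) (f i))"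
  by (induction I rule: infinite_finite_induct) (simp_all add: poly_carlitz_add)

text \<open>
  In the induction step, with \<open>F\<close> and \<open>E\<close> the values at \<open>x\<close> of \<open>carlitz d\<close> and \<open>carlitz (Suc d)\<close>, the terms
  in \<open>F\<close> are eliminated by the \<open>q\<close>-th power of the recursion, \<open>(F ^ q) ^ q - F ^ q = ([d+1] E) ^ q\<close>; what
  remains matches because \<open>[d+2] = [d+1] ^ q + [1]\<close>.
\<close>
lemma poly_carlitz_theta:
  fixes x :: "'k::{finite,field} alg_closure fls"
  shows "poly (carlitz (Suc d)) (theta * x) =
    theta * poly (carlitz (Suc d)) x + poly (carlitz d) x ^ CARD('k)"
proof -
  let ?q = "CARD('k)" and ?T = "bracket TYPE('k)"
  have "?T (Suc d) * poly (carlitz (Suc d)) (theta * x) =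
    ?T (Suc d) * (theta * poly (carlitz (Suc d)) x + poly (carlitz d) x ^ ?q)"
  proof (induction d)
    case 0
    show ?case using bracket_nonzero[of 0, where 'k = 'k]
      by (simp add: distrib_left power_mult_distrib) (simp add: bracket_def algebra_simps)
  next
    case (Suc d)
    define E where "E = poly (carlitz (Suc d)) x"
    define F where "F = poly (carlitz d) x"
    have IH: "poly (carlitz (Suc d)) (theta * x) = theta * E + F ^ ?q"
      using Suc bracket_nonzero[of d, where 'k = 'k] unfolding E_def F_def by simp
    have "(E * ?T (Suc d)) ^ ?q = (F ^ ?q - F) ^ ?q"
      unfolding E_def F_def by (simp only: poly_carlitz_Suc)
    hence F: "E ^ ?q * ?T (Suc d) ^ ?q = (F ^ ?q) ^ ?q - F ^ ?q"
      by (simp add: power_mult_distrib frobenius_diff)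
    have "?T (Suc (Suc d)) * poly (carlitz (Suc (Suc d))) (theta * x)
      = (theta * E + F ^ ?q) ^ ?q - (theta * E + F ^ ?q)"
      using poly_carlitz_Suc[of "Suc d" "theta * x"] by (simp only: IH mult.commute)
    also have "\<dots> = theta ^ ?q * E ^ ?q - theta * E + ((F ^ ?q) ^ ?q - F ^ ?q)"
      by (simp add: frobenius_add power_mult_distrib)
    also have "\<dots> = theta * (E ^ ?q - E) + (?T 1 + ?T (Suc d) ^ ?q) * E ^ ?q"
      unfolding F[symmetric] by (simp add: bracket_def algebra_simps)
    also have "\<dots> = theta * (E ^ ?q - E) + ?T (Suc (Suc d)) * E ^ ?q"
      by (simp only: bracket_Suc[of "Suc d"] add.commute)
    also have "E ^ ?q - E = poly (carlitz (Suc (Suc d))) x * ?T (Suc (Suc d))"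
      unfolding E_def by (simp only: poly_carlitz_Suc)
    finally show ?case by (simp only: E_def distrib_left mult.commute mult.left_commute)
  qed
  thus ?thesis using bracket_nonzero[of d, where 'k = 'k] by (simp only: mult_cancel_left) simp
qed

lemma poly_carlitz_theta_power:
  "(j < d \<longrightarrow> poly (carlitz d) (theta ^ j :: 'k::{finite,field} alg_closure fls) = 0) \<and>
   poly (carlitz d) (theta ^ d :: 'k alg_closure fls) = 1"
proof (induction d arbitrary: j)
  case 0
  show ?case by simp
next
  case (Suc d)
  have q: "CARD('k) > 0" using CARD_field_gt_1[where 'k = 'k] by simp
  have 0: "poly (carlitz (Suc d)) (theta ^ j :: 'k alg_closure fls) = 0" if "j < Suc d" for j
    using that
  proof (induction j)
    case 0
    show ?case using Suc.IH[of 0] q by (cases "d = 0") simp_all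
  next
    case (Suc j)
    thus ?case using \<open>\<And>j. (j < d \<longrightarrow> poly (carlitz d) (theta ^ j) = 0) \<and> _\<close>[of j] q
      by (simp only: power_Suc poly_carlitz_theta) simp
  qed
  have "poly (carlitz (Suc d)) (theta ^ Suc d :: 'k alg_closure fls) = 1"
    using 0[of d] Suc.IH by (simp only: power_Suc poly_carlitz_theta) simp
  thus ?case using 0 by blast
qed

definition monics :: "nat \<Rightarrow> 'k::field poly set"
  where "monics d = {a. lead_coeff a = 1 \<and> degree a = d}"

lemma poly_carlitz_monic:
  assumes "a \<in> monics d"
  shows "poly (carlitz d) (emb (a :: 'k::{finite,field} poly)) = 1"
proof -
  have a: "degree a = d" "coeff a d = 1" using assms by (auto simp: monics_def)
  have "poly (carlitz d) (emb a) = (\<Sum>i\<le>d. fls_const (to_ac (coeff a i)) * poly (carlitz d) (theta ^ i))"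
    by (simp add: emb_eq_sum poly_carlitz_sum poly_carlitz_scale a)
  also have "\<dots> = (\<Sum>i\<in>{d}. fls_const (to_ac (coeff a i)) * poly (carlitz d) (theta ^ i))"
    by (rule sum.mono_neutral_right) (auto simp: poly_carlitz_theta_power)
  also have "\<dots> = 1" using poly_carlitz_theta_power[of 0 d, where 'k = 'k] a by simp
  finally show ?thesis .
qed

lemma finite_monics: "finite (monics d :: 'k::{finite,field} poly set)"
  by (rule finite_subset[OF _ finite_polys_degree_less[of "Suc d"]]) (auto simp: monics_def)

text \<open>
  Counts the choices of the \<open>d\<close> coefficients below the leading one.
\<close>
lemma card_monics_ge: "CARD('k) ^ d \<le> card (monics d :: 'k::{finite,field} poly set)"
proof -
  let ?L = "{xs :: 'k list. set xs \<subseteq> UNIV \<and> length xs = d}"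
  define f where "f xs = Poly (xs @ [1 :: 'k])" for xs
  have deg: "f xs \<in> monics d" if "length xs = d" for xs
  proof -
    have "degree (f xs) = d"
      by (rule antisym, rule degree_le, use that in \<open>auto simp: f_def nth_default_def\<close>)
         (rule le_degree, use that in \<open>auto simp: f_def nth_default_def nth_append\<close>)
    thus ?thesis using that by (auto simp: monics_def f_def nth_default_def nth_append)
  qed
  have "inj_on f ?L"
  proof (rule inj_onI)
    fix xs ys assume *: "xs \<in> ?L" "ys \<in> ?L" "f xs = f ys"
    show "xs = ys"
    proof (rule nth_equalityI)
      fix i assume i: "i < length xs"
      have "coeff (f xs) i = coeff (f ys) i" using * by simp
      thus "xs ! i = ys ! i" using i * by (simp add: f_def nth_default_def nth_append)
    qed (use * in simp)
  qed
  hence "card ?L = card (f ` ?L)" by (simp add: card_image)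
  also have "\<dots> \<le> card (monics d :: 'k poly set)"
    by (intro card_mono finite_monics) (use deg in auto)
  finally show ?thesis using card_lists_length_eq[of "UNIV :: 'k set" d] by simp
qed

lemma degree_carlitz_le: "degree (carlitz d :: 'k::{finite,field} alg_closure fls poly) \<le> CARD('k) ^ d"
proof (induction d)
  case 0
  show ?case by simp
next
  case (Suc d)
  have "degree (carlitz d ^ CARD('k) :: 'k alg_closure fls poly) \<le> CARD('k) ^ Suc d"
    using Suc by (intro order.trans[OF degree_power_le]) (simp add: mult.commute)
  moreover have "degree (carlitz d :: 'k alg_closure fls poly) \<le> CARD('k) ^ Suc d"
    using Suc by (rule order.trans) (simp add: power_increasing)
  ultimately show ?case
    by (simp add: degree_diff_le del: power_Suc)
qed

lemma inj_emb: "inj_on emb A"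
proof (rule inj_onI)
  fix a b assume "emb a = emb b"
  hence "emb (a - b) = 0" by (simp add: emb_diff)
  thus "a = b" by simp
qed

text \<open>
  Both sides have degree at most the number of monic polynomials of degree \<open>d\<close>, vanish at all of
  these, and take the value \<open>1\<close> at \<open>0\<close>; this is one point of agreement more than the degree.
\<close>
lemma one_minus_carlitz_eq_prod:
  "1 - carlitz d = (\<Prod>a\<in>monics d. [:1, - (1 / emb (a :: 'k::{finite,field} poly)):])"
proof -
  let ?M = "monics d :: 'k poly set"
  define P where "P = (\<Prod>a\<in>?M. [:1, - (1 / emb a):])"
  define D where "D = 1 - carlitz d - P"
  have nz: "emb a \<noteq> 0" if "a \<in> ?M" for a using that by (auto simp: monics_def)
  have "degree P \<le> (\<Sum>a\<in>?M. degree [:1, - (1 / emb a):])"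
    unfolding P_def using degree_prod_sum_le[OF finite_monics, of "\<lambda>a. [:1, - (1 / emb a):]" d]
    by (simp add: o_def)
  also have "\<dots> \<le> (\<Sum>a\<in>?M. 1)" by (intro sum_mono) simp
  finally have "degree P \<le> card ?M" by simp
  moreover have "degree (1 - carlitz d :: 'k alg_closure fls poly) \<le> card ?M"
    using degree_carlitz_le[of d, where 'k = 'k] card_monics_ge[of d, where 'k = 'k]
    by (intro degree_diff_le) auto
  ultimately have deg: "degree D \<le> card ?M"
    unfolding D_def by (simp only: degree_diff_le)
  have root: "poly D x = 0" if x: "x \<in> insert 0 (emb ` ?M)" for x
  proof (cases "x = 0")
    case True
    thus ?thesis by (simp add: D_def P_def poly_prod)
  next
    case False
    then obtain a where a: "a \<in> ?M" "x = emb a" using x by auto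
    have "poly P x = 0"
      unfolding P_def poly_prod using a nz finite_monics by (intro prod_zero) (auto intro!: bexI[of _ a])
    thus ?thesis using a poly_carlitz_monic[OF a(1)] by (simp add: D_def)
  qed
  have "D = 0"
  proof (rule ccontr)
    assume "D \<noteq> 0"
    have "card (insert 0 (emb ` ?M)) = Suc (card ?M)"
      using nz finite_monics[of d, where 'k = 'k] by (subst card_insert_disjoint) (auto simp: card_image inj_emb)
    moreover have "card (insert 0 (emb ` ?M)) \<le> card {x. poly D x = 0}"
      using root \<open>D \<noteq> 0\<close> by (intro card_mono poly_roots_finite) auto
    moreover have "card {x. poly D x = 0} \<le> degree D"
      using \<open>D \<noteq> 0\<close> by (rule card_poly_roots_bound)
    ultimately show False using deg by simp
  qed
  thus ?thesis by (simp add: D_def P_def)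
qed

text \<open>
  The recursion reads \<open>carlitz (Suc d) = - carlitz d * (1 - carlitz d ^ (q - 1)) / [d+1]\<close>, and
  \<open>\<ell>\<^bsub>d+1\<^esub> = - [d+1] \<ell>\<^sub>d\<close>. With \<open>one_minus_carlitz_eq_prod\<close> the factor \<open>1 - carlitz j ^ (q - 1)\<close> collects
  the \<open>1 - x / (c a)\<close> for \<open>a\<close> monic of degree \<open>j\<close> and \<open>c\<close> a nonzero constant.
\<close>
lemma carlitz_eq_prod:
  "carlitz d = smult (1 / emb (ell d :: 'k::{finite,field} poly))
    ([:0, 1:] * (\<Prod>j<d. 1 - carlitz j ^ (CARD('k) - 1)))"
proof (induction d)
  case 0
  show ?case by (simp add: ell_def emb_1)
next
  case (Suc d)
  let ?E = "carlitz d :: 'k alg_closure fls poly"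
  have "?E ^ CARD('k) = ?E * ?E ^ (CARD('k) - 1)"
    using CARD_field_gt_1[where 'k = 'k] by (simp add: power_eq_if)
  hence "carlitz (Suc d) = smult (- (1 / bracket TYPE('k) (Suc d))) (?E * (1 - ?E ^ (CARD('k) - 1)))"
    by (simp add: algebra_simps smult_diff_right)
  also have "\<dots> = smult (- (1 / bracket TYPE('k) (Suc d)) * (1 / emb (ell d :: 'k poly)))
    ([:0, 1:] * (\<Prod>j<Suc d. 1 - carlitz j ^ (CARD('k) - 1)))"
    by (subst Suc) (simp only: mult_smult_left smult_smult prod.lessThan_Suc mult.assoc)
  also have "- (1 / bracket TYPE('k) (Suc d)) * (1 / emb (ell d :: 'k poly)) = 1 / emb (ell (Suc d) :: 'k poly)"
    by (simp add: emb_ell_Suc)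
  finally show ?case .
qed

text \<open>
  A \<open>q\<close>-th power has derivative \<open>0\<close>, so only the linear term of the recursion survives.
\<close>
lemma pderiv_carlitz:
  "pderiv (carlitz d) = [:1 / emb (ell d :: 'k::{finite,field} poly):]"
proof (induction d)
  case 0
  show ?case by (simp add: ell_def emb_1 pderiv_pCons)
next
  case (Suc d)
  have "pderiv (carlitz d ^ CARD('k) :: 'k alg_closure fls poly) = 0"
    using of_nat_CARD_fls_eq_0[where 'k = 'k] CARD_field_gt_1[where 'k = 'k]
    by (cases "CARD('k)") (simp_all only: pderiv_power_Suc, simp_all)
  thus ?case by (simp add: pderiv_smult pderiv_diff Suc emb_ell_Suc)
qed

section \<open>Power sums over monic polynomials\<close>

definition power_sum :: "nat \<Rightarrow> nat \<Rightarrow> 'k::{finite,field} alg_closure fls"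
  where "power_sum s d = (\<Sum>a\<in>(monics d :: 'k poly set). (1 / emb a) ^ s)"

text \<open>
  The logarithmic derivative as an identity of power series: \<open>v / (1 - v x)\<close> has the coefficients
  \<open>v ^ Suc n\<close>.
\<close>
lemma log_deriv_prod:
  fixes v :: "'i \<Rightarrow> 'a::field"
  assumes "finite M"
  shows "(\<Prod>a\<in>M. 1 - fps_const (v a) * fps_X) * Abs_fps (\<lambda>n. \<Sum>a\<in>M. v a ^ Suc n) =
    - fps_deriv (\<Prod>a\<in>M. 1 - fps_const (v a) * fps_X)"
  using assms
proof (induction M rule: finite_induct)
  case empty
  show ?case by (simp add: fps_zero_def[symmetric])
next
  case (insert a M)
  define P where "P = (\<Prod>a\<in>M. 1 - fps_const (v a) * fps_X)"
  define S where "S = Abs_fps (\<lambda>n. \<Sum>a\<in>M. v a ^ Suc n)"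
  define g where "g = Abs_fps (\<lambda>n. v a ^ Suc n)"
  define L where "L = 1 - fps_const (v a) * fps_X"
  have Lg: "L * g = fps_const (v a)"
  proof (rule fps_ext)
    fix n show "fps_nth (L * g) n = fps_nth (fps_const (v a)) n"
      by (cases n) (simp_all add: L_def g_def left_diff_distrib mult.assoc)
  qed
  have dL: "fps_deriv L = - fps_const (v a)" by (simp add: L_def)
  have "Abs_fps (\<lambda>n. \<Sum>a\<in>insert a M. v a ^ Suc n) = g + S"
    using insert.hyps by (intro fps_ext) (simp add: g_def S_def)
  moreover have "(\<Prod>a\<in>insert a M. 1 - fps_const (v a) * fps_X) = L * P"
    using insert.hyps by (simp add: L_def P_def)
  moreover have "L * P * (g + S) = - fps_deriv (L * P)"
  proof -
    have "L * P * (g + S) = (L * g) * P + L * (P * S)" by (simp add: algebra_simps)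
    also have "P * S = - fps_deriv P" using insert.IH by (simp add: P_def S_def)
    also have "(L * g) * P + L * - fps_deriv P = - fps_deriv (L * P)"
      unfolding Lg fps_deriv_mult dL by (simp add: algebra_simps del: fps_const_neg)
    finally show ?thesis .
  qed
  ultimately show ?case by simp
qed

text \<open>
  In \<open>log_deriv_prod\<close> for the \<open>v a = 1 / a\<close>, the product is \<open>1 - carlitz d\<close> and the right-hand side is the
  constant \<open>1 / \<ell>\<^sub>d\<close>.
\<close>
lemma power_sum_recursion:
  "power_sum (Suc n) d = (if n = 0 then 1 / emb (ell d :: 'k::{finite,field} poly) else 0) +
    (\<Sum>m=1..n. coeff (carlitz d) m * power_sum (Suc n - m) d)"
proof -
  define v where "v a = 1 / emb (a :: 'k poly)" for a
  define C where "C = fps_of_poly (carlitz d :: 'k alg_closure fls poly)"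
  define S where "S = Abs_fps (\<lambda>n. power_sum (Suc n) d :: 'k alg_closure fls)"
  have "fps_of_poly (1 - carlitz d) = (\<Prod>a\<in>monics d. fps_of_poly [:1, - (1 / emb (a :: 'k poly)):])"
    by (simp only: one_minus_carlitz_eq_prod fps_of_poly_prod)
  also have "\<dots> = (\<Prod>a\<in>monics d. 1 - fps_const (v a) * fps_X)"
    by (intro prod.cong refl) (simp only: fps_of_poly_linear' v_def, simp flip: fps_const_neg)
  finally have P: "1 - C = (\<Prod>a\<in>monics d. 1 - fps_const (v a) * fps_X)"
    by (simp add: C_def fps_of_poly_diff)
  have "(1 - C) * S = - fps_deriv (1 - C)"
    using log_deriv_prod[OF finite_monics[of d], of v] unfolding P S_def power_sum_def v_def .
  also have "\<dots> = fps_of_poly (pderiv (carlitz d))"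
    by (simp add: C_def fps_of_poly_pderiv)
  also have "\<dots> = fps_const (1 / emb (ell d :: 'k poly))"
    by (simp only: pderiv_carlitz fps_of_poly_const)
  finally have "S = fps_const (1 / emb (ell d :: 'k poly)) + C * S"
    by (simp add: algebra_simps)
  hence "fps_nth S n = fps_nth (fps_const (1 / emb (ell d :: 'k poly)) + C * S) n" by simp
  also have "\<dots> = (if n = 0 then 1 / emb (ell d :: 'k poly) else 0) +
     (\<Sum>m=0..n. coeff (carlitz d) m * power_sum (Suc (n - m)) d)"
    by (simp add: fps_mult_nth C_def S_def)
  also have "(\<Sum>m=0..n. coeff (carlitz d) m * power_sum (Suc (n - m)) d) =
    (\<Sum>m=1..n. coeff (carlitz d) m * power_sum (Suc n - m) d :: 'k alg_closure fls)"
    using poly_carlitz_0[of d, where 'k = 'k]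
    by (simp add: sum.atLeast_Suc_atMost poly_0_coeff_0 Suc_diff_le)
  finally show ?thesis by (simp add: S_def)
qed

section \<open>Nested sums as sums over decreasing lists\<close>

text \<open>
  The index sets of both kinds of values: monic polynomials graded by their degree, and natural
  numbers graded by themselves.
\<close>
definition decreasing_lists :: "'i set \<Rightarrow> ('i \<Rightarrow> nat) \<Rightarrow> nat \<Rightarrow> 'i list set"
  where "decreasing_lists M g n =
    {xs. length xs = n \<and> set xs \<subseteq> M \<and> sorted_wrt (\<lambda>a b. g a > g b) xs}"

definition decreasing_lists_below :: "'i set \<Rightarrow> ('i \<Rightarrow> nat) \<Rightarrow> nat \<Rightarrow> nat \<Rightarrow> 'i list set"
  where "decreasing_lists_below M g n d = {xs \<in> decreasing_lists M g n. \<forall>a\<in>set xs. g a < d}"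

lemma finite_below:
  fixes g :: "'i \<Rightarrow> nat"
  assumes "\<And>j. finite {a \<in> M. g a = j}"
  shows "finite {a \<in> M. g a < d}"
proof -
  have "{a \<in> M. g a < d} = (\<Union>j<d. {a \<in> M. g a = j})" by auto
  thus ?thesis using assms by simp
qed

lemma finite_decreasing_lists_below:
  assumes "\<And>j. finite {a \<in> M. g a = j}"
  shows "finite (decreasing_lists_below M g n d)"
proof (rule finite_subset)
  show "decreasing_lists_below M g n d \<subseteq> {xs. set xs \<subseteq> {a \<in> M. g a < d} \<and> length xs = n}"
    by (auto simp: decreasing_lists_below_def decreasing_lists_def)
  show "finite {xs. set xs \<subseteq> {a \<in> M. g a < d} \<and> length xs = n}"
    by (intro finite_lists_length_eq finite_below assms)
qed

text \<open>
  Splits off the head \<open>a\<close> of a decreasing list; the tail then ranges over the decreasing lists of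
  grade below \<open>g a\<close>, which is the truncation in the next inner nested sum.
\<close>
lemma nested_eq_sum_decreasing_lists:
  fixes v :: "'i \<Rightarrow> 'a::field fls" and g :: "'i \<Rightarrow> nat"
  assumes fin: "\<And>j. finite {a \<in> M. g a = j}"
    and u: "\<And>s j. u s j = (\<Sum>a | a \<in> M \<and> g a = j. v a ^ s)"
    and "length eps = length s"
  shows "nested u (zip (map fls_const eps) s) d =
    (\<Sum>xs\<in>decreasing_lists_below M g (length s) d.
      \<Prod>i<length s. fls_const ((eps ! i) ^ g (xs ! i)) * v (xs ! i) ^ (s ! i))"
  using assms(3)
proof (induction eps s arbitrary: d rule: list_induct2)
  case Nil
  have "decreasing_lists_below M g 0 d = {[]}"
    by (auto simp: decreasing_lists_below_def decreasing_lists_def)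
  thus ?case by simp
next
  case (Cons e eps t s)
  define n where "n = length s"
  define L where "L = decreasing_lists_below M g"
  define F where "F xs = (\<Prod>i<n. fls_const ((eps ! i) ^ g (xs ! i)) * v (xs ! i) ^ (s ! i))" for xs
  define h where "h a = fls_const (e ^ g a) * v a ^ t" for a
  define K where "K j = (\<Sum>xs\<in>L n j. F xs)" for j
  have IH: "nested u (zip (map fls_const eps) s) j = K j" for j
    unfolding K_def L_def n_def F_def by (rule Cons.IH)
  have "nested u (zip (map fls_const (e # eps)) (t # s)) d =
      (\<Sum>j<d. \<Sum>a | a \<in> M \<and> g a = j. h a * K (g a))"
    by (simp add: partial_sums_def leading_def IH u h_def sum_distrib_left sum_distrib_right
        fls_const_power mult.assoc)
  also have "\<dots> = (\<Sum>j<d. \<Sum>a\<in>{a \<in> {a \<in> M. g a < d}. g a = j}. h a * K (g a))"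
    by (intro sum.cong refl) auto
  also have "\<dots> = (\<Sum>a | a \<in> M \<and> g a < d. h a * K (g a))"
    by (rule sum.group) (use finite_below[OF fin] in auto)
  also have "\<dots> = (\<Sum>(a, xs)\<in>Sigma {a \<in> M. g a < d} (\<lambda>a. L n (g a)). h a * F xs)"
    unfolding K_def sum_distrib_left L_def
    by (rule sum.Sigma) (use finite_below[OF fin] finite_decreasing_lists_below[OF fin] in auto)
  also have "\<dots> = (\<Sum>xs\<in>L (Suc n) d. h (hd xs) * F (tl xs))"
  proof (rule sum.reindex_bij_witness[of _ "\<lambda>xs. (hd xs, tl xs)" "\<lambda>(a, xs). a # xs"])
    fix xs assume "xs \<in> L (Suc n) d"
    thus "(case (hd xs, tl xs) of (a, xs) \<Rightarrow> a # xs) = xs"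
      and "(hd xs, tl xs) \<in> Sigma {a \<in> M. g a < d} (\<lambda>a. L n (g a))"
      by (cases xs; auto simp: L_def decreasing_lists_below_def decreasing_lists_def)+
  qed (auto simp: L_def decreasing_lists_below_def decreasing_lists_def)
  also have "\<dots> = (\<Sum>xs\<in>L (Suc n) d. \<Prod>i<Suc n.
      fls_const (((e # eps) ! i) ^ g (xs ! i)) * v (xs ! i) ^ ((t # s) ! i))"
  proof (rule sum.cong[OF refl])
    fix xs assume "xs \<in> L (Suc n) d"
    then obtain a ys where "xs = a # ys"
      by (cases xs) (auto simp: L_def decreasing_lists_below_def decreasing_lists_def)
    thus "h (hd xs) * F (tl xs) = (\<Prod>i<Suc n.
        fls_const (((e # eps) ! i) ^ g (xs ! i)) * v (xs ! i) ^ ((t # s) ! i))"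
      unfolding prod.lessThan_Suc_shift by (simp add: h_def F_def)
  qed
  finally show ?case by (simp add: L_def n_def)
qed

section \<open>Coefficientwise limits\<close>

text \<open>
  Convergence in which every coefficient becomes stationary. Integral combinations pass to such
  limits coefficient by coefficient.
\<close>
definition coeffwise_limit :: "(nat \<Rightarrow> 'a::comm_ring_1 fls) \<Rightarrow> 'a fls \<Rightarrow> bool"
  where "coeffwise_limit f v \<longleftrightarrow> (\<forall>n. \<forall>\<^sub>F d in sequentially. f d $$ n = v $$ n)"

lemma coeffwise_limit_unique:
  assumes "coeffwise_limit f v" "coeffwise_limit f w"
  shows "v = w"
proof (rule fls_eqI)
  fix n
  have "\<forall>\<^sub>F d in sequentially. f d $$ n = v $$ n \<and> f d $$ n = w $$ n"
    using assms by (auto simp: coeffwise_limit_def intro: eventually_conj)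
  hence "\<forall>\<^sub>F d::nat in sequentially. v $$ n = w $$ n"
    by (rule eventually_mono) auto
  thus "v $$ n = w $$ n" by simp
qed

lemma coeffwise_limit_in_int_span:
  assumes f: "f \<in> int_span A"
    and lim: "\<And>a. a \<in> A \<Longrightarrow> \<exists>v\<in>B. coeffwise_limit a v"
  shows "\<exists>v\<in>int_span B. coeffwise_limit f v"
  using f
proof (induction rule: int_module.span_induct_alt)
  case base
  show ?case
    by (rule bexI[of _ 0]) (auto simp: coeffwise_limit_def int_module.span_zero)
next
  case (step c a f)
  then obtain v w where vw: "v \<in> int_span B" "coeffwise_limit f v" "w \<in> B" "coeffwise_limit a w"
    using lim by blast
  have "of_int c * w + v \<in> int_span B"
    by (intro int_module.span_add int_module.span_scale int_module.span_base[of w]) (use vw in auto)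
  moreover have "coeffwise_limit (of_int c * a + f) (of_int c * w + v)"
    unfolding coeffwise_limit_def
  proof
    fix n
    have of_int: "(of_int c :: nat \<Rightarrow> 'a fls) d = of_int c" for d
      by (cases c) (simp_all add: of_nat_fun)
    have "\<forall>\<^sub>F d in sequentially. a d $$ n = w $$ n \<and> f d $$ n = v $$ n"
      using vw by (auto simp: coeffwise_limit_def intro: eventually_conj)
    thus "\<forall>\<^sub>F d in sequentially. (of_int c * a + f) d $$ n = (of_int c * w + v) $$ n"
      by (rule eventually_mono) (simp add: of_int fls_of_int)
  qed
  ultimately show ?case by blast
qed

lemma coeffwise_limit_infsum:
  fixes F :: "'i list \<Rightarrow> 'a::field fls"
  assumes fibres: "\<And>j. finite {a \<in> M. g a = j}"
    and fin: "\<And>m. finite {xs \<in> decreasing_lists M g n. F xs \<noteq> 0 \<and> fls_subdegree (F xs) < m}"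
  shows "coeffwise_limit (\<lambda>d. \<Sum>xs\<in>decreasing_lists_below M g n d. F xs)
    (infsum F (decreasing_lists M g n))"
  unfolding coeffwise_limit_def
proof
  fix m
  let ?L = "decreasing_lists M g n"
  \<comment> \<open>Only finitely many terms contribute to the coefficient, so some truncation contains all of them.\<close>
  define S where "S = {xs \<in> ?L. F xs $$ m \<noteq> 0}"
  have "finite S"
    by (rule finite_subset[OF _ fin[of "m + 1"]]) (auto simp: S_def dest: fls_subdegree_leI)
  hence "finite (\<Union>xs\<in>S. g ` set xs)" by simp
  then obtain D where D: "\<And>xs a. xs \<in> S \<Longrightarrow> a \<in> set xs \<Longrightarrow> g a < D"
    unfolding finite_nat_set_iff_bounded by blast
  have "(\<Sum>xs\<in>decreasing_lists_below M g n d. F xs) $$ m = infsum F ?L $$ m" if "d \<ge> D" for d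
  proof -
    have "(\<Sum>xs\<in>decreasing_lists_below M g n d. F xs $$ m) = (\<Sum>xs\<in>S. F xs $$ m)"
      by (rule sum.mono_neutral_right)
         (use finite_decreasing_lists_below[OF fibres] D that in
           \<open>force simp: S_def decreasing_lists_below_def\<close>)+
    thus ?thesis by (simp add: fls_summable(2)[OF fin] fls_nth_sum S_def)
  qed
  thus "\<forall>\<^sub>F d in sequentially. (\<Sum>xs\<in>decreasing_lists_below M g n d. F xs) $$ m = infsum F ?L $$ m"
    by (auto simp: eventually_sequentially)
qed

abbreviation word :: "'a::zero list \<Rightarrow> nat list \<Rightarrow> ('a fls \<times> nat) list"
  where "word eps s \<equiv> zip (map fls_const eps) s"

definition inv_ell :: "nat \<Rightarrow> 'k::{finite,field} alg_closure fls"
  where "inv_ell d = 1 / emb (ell d :: 'k poly)"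

lemma cyc_mzv_limit:
  fixes eps :: "'k::{finite,field} alg_closure list"
  assumes "(eps, s) \<in> cyc_indices N w"
  shows "coeffwise_limit (nested power_sum (word eps s)) (cyc_mzv eps s)"
proof -
  let ?M = "{a :: 'k poly. lead_coeff a = 1}"
  define F where "F as =
    (\<Prod>i<length s. fls_const ((eps ! i) ^ degree (as ! i)) / emb (as ! i) ^ (s ! i))" for as :: "'k poly list"
  have s: "\<forall>x\<in>set s. x \<ge> 1" "length eps = length s" using assms by (auto simp: cyc_indices_def)
  have L: "decreasing_lists ?M degree n = decreasing_monics n" for n
    by (auto simp: decreasing_lists_def decreasing_monics_def)
  have monics: "{a \<in> ?M. degree a = j} = monics j" for j by (auto simp: monics_def)
  have fibres: "finite {a \<in> ?M. degree a = j}" for j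
    unfolding monics by (rule finite_monics)
  have "coeffwise_limit (\<lambda>d. \<Sum>as\<in>decreasing_lists_below ?M degree (length s) d. F as)
    (infsum F (decreasing_lists ?M degree (length s)))"
    by (rule coeffwise_limit_infsum[OF fibres])
       (use cyc_mzv_summable(1)[OF s(1), of eps] in \<open>simp only: L F_def\<close>)
  also have "infsum F (decreasing_lists ?M degree (length s)) = cyc_mzv eps s"
    by (simp only: cyc_mzv_def L F_def[abs_def])
  also have "(\<lambda>d. \<Sum>as\<in>decreasing_lists_below ?M degree (length s) d. F as) =
      nested power_sum (word eps s)"
  proof
    fix d
    have "nested power_sum (word eps s) d = (\<Sum>as\<in>decreasing_lists_below ?M degree (length s) d.
        \<Prod>i<length s. fls_const ((eps ! i) ^ degree (as ! i)) * (1 / emb (as ! i)) ^ (s ! i))"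
    proof (rule nested_eq_sum_decreasing_lists[OF fibres])
      fix t j
      have "{a. a \<in> ?M \<and> degree a = j} = monics j" by (auto simp: monics_def)
      thus "power_sum t j = (\<Sum>a | a \<in> ?M \<and> degree a = j. (1 / emb a) ^ t)"
        by (simp only: power_sum_def)
    qed fact
    thus "(\<Sum>as\<in>decreasing_lists_below ?M degree (length s) d. F as) = nested power_sum (word eps s) d"
      by (simp add: F_def power_one_over)
  qed
  finally show ?thesis .
qed

lemma cmpl_limit:
  fixes eps :: "'k::{finite,field} alg_closure list"
  assumes "(eps, s) \<in> cyc_indices N w"
  shows "coeffwise_limit (nested (powers inv_ell) (word eps s)) (cmpl eps s)"
proof -
  define F where "F ds =
    (\<Prod>i<length s. fls_const ((eps ! i) ^ (ds ! i)) / emb (ell (ds ! i) :: 'k poly) ^ (s ! i))" for ds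
  have s: "\<forall>x\<in>set s. x \<ge> 1" "length eps = length s" using assms by (auto simp: cyc_indices_def)
  have L: "decreasing_lists UNIV (\<lambda>j. j) n = decreasing_nats n" for n
    by (auto simp: decreasing_lists_def decreasing_nats_def)
  have fibres: "finite {a :: nat \<in> UNIV. a = j}" for j by simp
  have "coeffwise_limit (\<lambda>d. \<Sum>ds\<in>decreasing_lists_below UNIV (\<lambda>j. j) (length s) d. F ds)
    (infsum F (decreasing_lists UNIV (\<lambda>j. j) (length s)))"
    by (rule coeffwise_limit_infsum[OF fibres])
       (use cmpl_summable(1)[OF s(1), of eps] in \<open>simp only: L F_def\<close>)
  also have "infsum F (decreasing_lists UNIV (\<lambda>j. j) (length s)) = cmpl eps s"
    by (simp only: cmpl_def L F_def[abs_def])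
  also have "(\<lambda>d. \<Sum>ds\<in>decreasing_lists_below UNIV (\<lambda>j. j) (length s) d. F ds) =
      nested (powers inv_ell) (word eps s)"
  proof
    fix d
    have "nested (powers inv_ell) (word eps s) d = (\<Sum>ds\<in>decreasing_lists_below UNIV (\<lambda>j. j) (length s) d.
        \<Prod>i<length s. fls_const ((eps ! i) ^ (ds ! i)) * inv_ell (ds ! i) ^ (s ! i))"
      by (rule nested_eq_sum_decreasing_lists[OF fibres])
         (use s in \<open>simp_all add: powers_def power_fun_apply\<close>)
    thus "(\<Sum>ds\<in>decreasing_lists_below UNIV (\<lambda>j. j) (length s) d. F ds) = nested (powers inv_ell) (word eps s) d"
      by (simp add: F_def inv_ell_def power_one_over)
  qed
  finally show ?thesis .
qed

section \<open>Comparison of the two families of values\<close>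

interpretation roots: coefficient_monoid "fls_const ` (roots_unity N :: 'k::{finite,field} alg_closure set)"
  for N
proof
  show "1 \<in> fls_const ` (roots_unity N :: 'k alg_closure set)"
    by (rule image_eqI[of _ _ 1]) (auto simp: roots_unity_def)
next
  fix x y :: "'k alg_closure fls"
  assume "x \<in> fls_const ` roots_unity N" "y \<in> fls_const ` roots_unity N"
  then obtain a b where "x = fls_const a" "y = fls_const b" "a ^ N = 1" "b ^ N = 1"
    by (auto simp: roots_unity_def)
  thus "x * y \<in> fls_const ` roots_unity N"
    by (intro image_eqI[of _ _ "a * b"]) (auto simp: roots_unity_def power_mult_distrib fls_const_mult_const)
qed

text \<open>
  The heart of the argument: the recursion for power sums has the coefficients of the polynomials
  \<open>carlitz d\<close>, and by the product formula these are nested sums whose leading exponent is only \<open>1\<close>.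
\<close>
lemma power_sum_unitriangular:
  assumes "s \<ge> 1"
  shows "(power_sum s :: nat \<Rightarrow> 'k::{finite,field} alg_closure fls) - powers inv_ell s
    \<in> roots.leading_span N (powers inv_ell) (s - 1) s"
proof (rule roots.unitriangular_of_recursion[where c = "\<lambda>m d. coeff (carlitz d) m"])
  have q: "CARD('k) - 1 \<ge> 1" using CARD_field_gt_1[where 'k = 'k] by simp
  show "(\<lambda>d. coeff (carlitz d :: 'k alg_closure fls poly) m) \<in> roots.leading_span N (powers inv_ell) 1 m" if "m \<ge> 1" for m
    by (rule roots.coeff_in_leading_span[OF _ q that]) (unfold inv_ell_def, rule carlitz_eq_prod)
  show "(\<lambda>d. coeff (carlitz d :: 'k alg_closure fls poly) 1) = inv_ell"
  proof
    fix d
    have "coeff (pderiv (carlitz d)) 0 = (inv_ell d :: 'k alg_closure fls)"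
      by (simp only: pderiv_carlitz inv_ell_def) simp
    thus "coeff (carlitz d) 1 = (inv_ell d :: 'k alg_closure fls)" by (simp add: coeff_pderiv)
  qed
  show "power_sum (Suc n) = (if n = 0 then inv_ell else 0) +
      (\<Sum>m = 1..n. (\<lambda>d. coeff (carlitz d) m) * power_sum (Suc n - m) :: nat \<Rightarrow> 'k alg_closure fls)" for n
  proof
    fix d
    have "(\<Sum>m = 1..n. (\<lambda>d. coeff (carlitz d) m) * power_sum (Suc n - m) :: nat \<Rightarrow> 'k alg_closure fls) d
      = (\<Sum>m = 1..n. coeff (carlitz d) m * power_sum (Suc n - m) d)"
      by (induction rule: infinite_finite_induct) simp_all
    thus "power_sum (Suc n) d = ((if n = 0 then inv_ell else 0) +
      (\<Sum>m = 1..n. (\<lambda>d. coeff (carlitz d) m) * power_sum (Suc n - m) :: nat \<Rightarrow> 'k alg_closure fls)) d"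
      using power_sum_recursion[of n d, where 'k = 'k] by (simp add: inv_ell_def)
  qed
qed fact

lemma nested_span_power_sum:
  "roots.nested_span N (power_sum :: nat \<Rightarrow> nat \<Rightarrow> 'k::{finite,field} alg_closure fls) w =
   roots.nested_span N (powers inv_ell) w"
  by (rule equalityI)
     (rule roots.nested_span_subset_of_unitriangular roots.nested_span_supset_of_unitriangular,
      erule power_sum_unitriangular)+

lemma words_roots_eq:
  assumes "w \<ge> 1"
  shows "roots.words N w = (\<lambda>(eps, s). word eps s) ` (cyc_indices N w :: ('k::{finite,field} alg_closure list \<times> _) set)"
proof (intro equalityI subsetI)
  fix x assume x: "x \<in> roots.words N w"
  define eps s where "eps = map (\<lambda>a. fst a $$ 0) x" and "s = map snd x"
  have "fst a = fls_const (fst a $$ 0) \<and> fst a $$ 0 \<in> roots_unity N \<and> snd a \<ge> 1" if "a \<in> set x" for a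
    using x that by (fastforce simp: roots.words_def)
  hence "word eps s = x" "set eps \<subseteq> roots_unity N" "\<forall>t\<in>set s. t \<ge> 1"
    by (auto simp: eps_def s_def zip_map_map zip_same_conv_map comp_def intro!: map_idI prod_eqI)
  moreover have "s \<noteq> []" "sum_list s = w"
    using x assms by (auto simp: roots.words_def s_def)
  ultimately show "x \<in> (\<lambda>(eps, s). word eps s) ` cyc_indices N w"
    by (intro image_eqI[of _ _ "(eps, s)"]) (auto simp: cyc_indices_def eps_def s_def)
next
  fix x assume "x \<in> (\<lambda>(eps, s). word eps s) ` (cyc_indices N w :: ('k alg_closure list \<times> _) set)"
  then obtain eps s where x: "x = word eps s" "(eps, s) \<in> cyc_indices N w" by auto
  hence "length eps = length s" "set eps \<subseteq> roots_unity N" "\<forall>t\<in>set s. t \<ge> 1" "sum_list s = w"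
    by (auto simp: cyc_indices_def)
  moreover have "a \<in> fls_const ` set eps \<and> t \<in> set s" if "(a, t) \<in> set (word eps s)" for a t
    using set_zip_leftD[OF that] set_zip_rightD[OF that] by simp
  ultimately show "x \<in> roots.words N w"
    unfolding x(1) roots.words_def by fastforce
qed

text \<open>
  Any integral relation between the truncated sums survives in the limit, since limits are unique.
\<close>
lemma limit_in_int_span_limits:
  fixes val :: "'k::{finite,field} alg_closure list \<Rightarrow> nat list \<Rightarrow> 'k alg_closure fls"
  assumes "w \<ge> 1" and eq: "roots.nested_span N u w = roots.nested_span N v w"
    and u: "\<And>eps s. (eps, s) \<in> cyc_indices N w \<Longrightarrow> coeffwise_limit (nested u (word eps s)) (val eps s)"
    and v: "\<And>eps s. (eps, s) \<in> cyc_indices N w \<Longrightarrow> coeffwise_limit (nested v (word eps s)) (val' eps s)"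
    and idx: "(eps, s) \<in> cyc_indices N w"
  shows "val eps s \<in> int_span {val' eps s |eps s. (eps, s) \<in> cyc_indices N w}"
proof -
  have "word eps s \<in> roots.words N w"
    unfolding words_roots_eq[OF assms(1)] using idx by force
  hence "nested u (word eps s) \<in> roots.nested_span N u w"
    unfolding roots.nested_span_def by (intro int_module.span_base imageI)
  hence "nested u (word eps s) \<in> roots.nested_span N v w" by (simp only: eq)
  then obtain x where x: "x \<in> int_span {val' eps s |eps s. (eps, s) \<in> cyc_indices N w}"
      "coeffwise_limit (nested u (word eps s)) x"
    unfolding roots.nested_span_def words_roots_eq[OF assms(1)]
    using coeffwise_limit_in_int_span[of "nested u (word eps s)" _ "{val' eps s |eps s. (eps, s) \<in> cyc_indices N w}"] v
    by fast
  have "val eps s = x" using coeffwise_limit_unique[OF u[OF idx] x(2)] .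
  thus ?thesis using x(1) by (simp only:)
qed

text \<open>
  Closure properties of \<open>span_over\<close>. Sums need care because the coefficients are given on a finite
  subset of the generators: two such coefficient functions are extended by \<open>0\<close> to the union.
\<close>
lemma
  fixes S :: "'k::{finite,field} alg_closure fls set"
  shows span_over_zero: "0 \<in> span_over (cyc_rat_field N) S"
    and span_over_add: "\<And>x y. x \<in> span_over (cyc_rat_field N) S \<Longrightarrow> y \<in> span_over (cyc_rat_field N) S \<Longrightarrow>
      x + y \<in> span_over (cyc_rat_field N) S"
    and span_over_scale: "\<And>c x. c \<in> cyc_rat_field N \<Longrightarrow> x \<in> span_over (cyc_rat_field N) S \<Longrightarrow>
      c * x \<in> span_over (cyc_rat_field N) S"
    and span_over_base: "\<And>x. x \<in> S \<Longrightarrow> x \<in> span_over (cyc_rat_field N) S"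
proof -
  note closed = generate_field_zero generate_field_one generate_field_add generate_field_mult
  show "0 \<in> span_over (cyc_rat_field N) S"
    unfolding span_over_def by (auto intro!: exI[of _ "{}"])
  show "c * x \<in> span_over (cyc_rat_field N) S"
    if c: "c \<in> cyc_rat_field N" and x: "x \<in> span_over (cyc_rat_field N) S" for c x
  proof -
    obtain T b where b: "x = (\<Sum>v\<in>T. b v * v)" "finite T" "T \<subseteq> S" "\<forall>v\<in>T. b v \<in> cyc_rat_field N"
      using x unfolding span_over_def by blast
    have "c * x = (\<Sum>v\<in>T. (c * b v) * v)" by (simp add: b(1) sum_distrib_left mult.assoc)
    moreover have "\<forall>v\<in>T. c * b v \<in> cyc_rat_field N"
      using b(4) c unfolding cyc_rat_field_def by (auto intro: closed)
    ultimately show ?thesis using b(2,3) unfolding span_over_def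
      by (auto intro!: exI[of _ T] exI[of _ "\<lambda>v. c * b v"])
  qed
  show "x \<in> span_over (cyc_rat_field N) S" if "x \<in> S" for x
    unfolding span_over_def using that
    by (auto intro!: exI[of _ "{x}"] exI[of _ "\<lambda>_. 1"] simp: cyc_rat_field_def closed)
  show "x + y \<in> span_over (cyc_rat_field N) S"
    if x: "x \<in> span_over (cyc_rat_field N) S" and y: "y \<in> span_over (cyc_rat_field N) S" for x y
  proof -
    obtain T b where b: "x = (\<Sum>v\<in>T. b v * v)" "finite T" "T \<subseteq> S" "\<forall>v\<in>T. b v \<in> cyc_rat_field N"
      using x unfolding span_over_def by blast
    obtain T' b' where b': "y = (\<Sum>v\<in>T'. b' v * v)" "finite T'" "T' \<subseteq> S" "\<forall>v\<in>T'. b' v \<in> cyc_rat_field N"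
      using y unfolding span_over_def by blast
    define B where "B v = (if v \<in> T then b v else 0) + (if v \<in> T' then b' v else 0)" for v
    have "x = (\<Sum>v\<in>T \<union> T'. (if v \<in> T then b v else 0) * v)"
      unfolding b(1) by (rule sum.mono_neutral_cong_left) (use b(2) b'(2) in auto)
    moreover have "y = (\<Sum>v\<in>T \<union> T'. (if v \<in> T' then b' v else 0) * v)"
      unfolding b'(1) by (rule sum.mono_neutral_cong_left) (use b(2) b'(2) in auto)
    ultimately have "x + y = (\<Sum>v\<in>T \<union> T'. B v * v)"
      by (simp add: B_def distrib_right sum.distrib)
    moreover have "\<forall>v\<in>T \<union> T'. B v \<in> cyc_rat_field N"
      using b(4) b'(4) unfolding cyc_rat_field_def B_def by (auto intro!: closed)
    ultimately show ?thesis using b(2,3) b'(2,3) unfolding span_over_def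
      by (auto intro!: exI[of _ "T \<union> T'"] exI[of _ B])
  qed
qed

lemma of_int_in_cyc_rat_field: "of_int c \<in> cyc_rat_field N"
proof (induction c rule: int_induct[where k = 0])
  case (step2 i)
  have "(of_int (i - 1) :: 'a alg_closure fls) = of_int i + - 1" by simp
  with step2 show ?case
    unfolding cyc_rat_field_def by (simp only: generate_field_add generate_field_uminus generate_field_one)
qed (auto simp: cyc_rat_field_def intro: generate_field_zero generate_field_one generate_field_add)

lemma span_over_mono_int_span:
  fixes A :: "'k::{finite,field} alg_closure fls set"
  assumes "A \<subseteq> int_span B"
  shows "span_over (cyc_rat_field N) A \<subseteq> span_over (cyc_rat_field N) B"
proof
  fix x assume "x \<in> span_over (cyc_rat_field N) A"
  then obtain T b where b: "x = (\<Sum>v\<in>T. b v * v)" "T \<subseteq> A" "\<forall>v\<in>T. b v \<in> cyc_rat_field N"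
    unfolding span_over_def by blast
  have "int_span B \<subseteq> span_over (cyc_rat_field N) B"
    by (rule int_module.span_minimal)
       (auto simp: int_module.subspace_def intro: span_over_zero span_over_add span_over_scale
         span_over_base of_int_in_cyc_rat_field)
  hence "b v * v \<in> span_over (cyc_rat_field N) B" if "v \<in> T" for v
    using that b assms by (intro span_over_scale) auto
  thus "x \<in> span_over (cyc_rat_field N) B"
    unfolding b(1) by (induction T rule: infinite_finite_induct) (auto intro: span_over_zero span_over_add)
qed

text \<open>
  The generators of either space are integral combinations of the generators of the other, so the
  spans over any field agree.
\<close>
theorem theorem1p9:
  fixes N w :: nat
  assumes "N \<ge> 1" and "w \<ge> 1"
  shows "(CZ N w :: 'k::{finite,field} alg_closure fls set) = CL N w"
proof
  let ?Z = "{cyc_mzv eps s |eps s. (eps, s) \<in> cyc_indices N w} :: 'k alg_closure fls set"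
  let ?L = "{cmpl eps s |eps s. (eps, s) \<in> cyc_indices N w} :: 'k alg_closure fls set"
  have "?Z \<subseteq> int_span ?L"
    by (auto intro!: limit_in_int_span_limits[OF assms(2) nested_span_power_sum] intro: cyc_mzv_limit cmpl_limit)
  thus "(CZ N w :: 'k alg_closure fls set) \<subseteq> CL N w"
    unfolding CZ_def CL_def by (rule span_over_mono_int_span)
  have "?L \<subseteq> int_span ?Z"
    by (auto intro!: limit_in_int_span_limits[OF assms(2) nested_span_power_sum[symmetric]] intro: cyc_mzv_limit cmpl_limit)
  thus "CL N w \<subseteq> (CZ N w :: 'k alg_closure fls set)"
    unfolding CZ_def CL_def by (rule span_over_mono_int_span)
qed

end
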